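(* Let $(M,g)=(B\times_f F,\ g_B+f^2g_F)$ be a warped product manifold, let $(\overline{M},\overline{g})=(\overline{M}(c),\overline{g},J)$ be a complex space form of constant holomorphic sectional curvature $c$, and let $\psi:(M,g)\to(\overline{M},\overline{g})$ be an isometric immersion. Let $m_1=\dim B$, $m_2=\dim F$ and $m=m_1+m_2$. If $c\ge 0$, then $$\frac{m_1 m^2}{2(m-1)}H^2-\frac{m_1}{2}\|h\|^2+m_1\frac{c}{4}\ \le\ \frac{\triangle f}{f}\ \le\ \frac{m^2}{4m_2}H^2+m_1c,$$ and if $c<0$, then $$\frac{m_1 m^2}{2(m-1)}H^2-\frac{m_1}{2}\|h\|^2+m_1c\ \le\ \frac{\triangle f}{f}\ \le\ \frac{m^2}{4m_2}H^2+m_1\frac{c}{4}.$$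
   Context: $(B,g_B)$ and $(F,g_F)$ are Riemannian manifolds (of positive dimension), $f:B\to\mathbb{R}^+$ is a smooth positive function (the warping function), and $B\times_f F$ is the product $B\times F$ with the metric $g=g_B+f^2g_F$; $f$ is also regarded as a function on $M$ via the projection to $B$. All dimensions are real. The Laplacian is $\triangle f=\sum_{i=1}^m\big((\nabla_{v_i}v_i)f-v_i^2f\big)$ for a local orthonormal frame $v_1,\dots,v_m$ of $TM$, where $\nabla$ is the Levi-Civita connection of $M$ (note the sign). $h$ is the second fundamental form of $M$ in $\overline{M}$, the mean curvature vector is $H=\frac1m\sum_{i=1}^m h(v_i,v_i)$, $H^2=\overline{g}(H,H)$, and $\|h\|^2=\sum_{i,j=1}^m\overline{g}(h(v_i,v_j),h(v_i,v_j))$. The inequalities are between functions on $M$, at every point. A complex space form $(\overline{M}(c),\overline{g},J)$ is a Kähler manifold of constant holomorphic sectional curvature $c$; its curvature tensor is $$\overline{R}(X,Y)Z=\tfrac{c}{4}\big(\overline{g}(Y,Z)X-\overline{g}(X,Z)Y+\overline{g}(JY,Z)JX-\overline{g}(JX,Z)JY-2\overline{g}(JX,Y)JZ\big).$$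
   Formalization: The Laplacian of f is that of the base (B, g_B), not of the warped product M: with M's Laplacian the lower bound fails (polar coordinates in the flat complex plane, f = r, c = 0), while the upper bound for M's Laplacian follows from the one proved. *)

theory Defs
  imports "HOL-Analysis.Analysis"
begin

section \<open>Smooth functions and smooth manifolds\<close>

text \<open>
  Only used for open S. Existence and continuity of all iterated directional derivatives
  (with differentiability at each stage) is smoothness in the finite-dimensional setting.
\<close>
primrec Ck_on :: "nat \<Rightarrow> 'a::real_normed_vector set \<Rightarrow> ('a \<Rightarrow> 'b::real_normed_vector) \<Rightarrow> bool" where
  "Ck_on 0 S f \<longleftrightarrow> continuous_on S f"
| "Ck_on (Suc k) S f \<longleftrightarrow> (\<forall>x\<in>S. f differentiable (at x)) \<and>
      (\<forall>v. Ck_on k S (\<lambda>x. frechet_derivative f (at x) v))"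

definition smooth_on :: "'a::real_normed_vector set \<Rightarrow> ('a \<Rightarrow> 'b::real_normed_vector) \<Rightarrow> bool" where
  "smooth_on S f \<longleftrightarrow> (\<forall>k. Ck_on k S f)"

text \<open>
  A chart is a pair of an open domain and a coordinate map into the model space 'e; the dimension
  of the manifold is DIM('e), which is always positive. A manifold is given by a smooth atlas
  (not required to be maximal); its points are the points covered by the charts. Hausdorffness
  and second countability come from the type classes of the ambient space.
\<close>
type_synonym ('a, 'e) chart = "'a set \<times> ('a \<Rightarrow> 'e)"
type_synonym ('a, 'e) atlas = "('a, 'e) chart set"

definition chart_inv :: "('a, 'e) chart \<Rightarrow> 'e \<Rightarrow> 'a" where
  "chart_inv \<kappa> = inv_into (fst \<kappa>) (snd \<kappa>)"

definition carrier_of :: "('a, 'e) atlas \<Rightarrow> 'a set" where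
  "carrier_of A = (\<Union>\<kappa>\<in>A. fst \<kappa>)"

definition is_chart :: "('a::topological_space, 'e::euclidean_space) chart \<Rightarrow> bool" where
  "is_chart \<kappa> \<longleftrightarrow> open (fst \<kappa>) \<and> open (snd \<kappa> ` fst \<kappa>) \<and>
     homeomorphism (fst \<kappa>) (snd \<kappa> ` fst \<kappa>) (snd \<kappa>) (chart_inv \<kappa>)"

definition smooth_atlas ::
  "('a::{t2_space,second_countable_topology}, 'e::euclidean_space) atlas \<Rightarrow> bool" where
  "smooth_atlas A \<longleftrightarrow> (\<forall>\<kappa>\<in>A. is_chart \<kappa>) \<and>
     (\<forall>\<kappa>\<in>A. \<forall>\<kappa>'\<in>A. smooth_on (snd \<kappa> ` (fst \<kappa> \<inter> fst \<kappa>')) (snd \<kappa>' \<circ> chart_inv \<kappa>))"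

definition smooth_function ::
  "('a, 'e::euclidean_space) atlas \<Rightarrow> ('a \<Rightarrow> real) \<Rightarrow> bool" where
  "smooth_function A f \<longleftrightarrow> (\<forall>\<kappa>\<in>A. smooth_on (snd \<kappa> ` fst \<kappa>) (f \<circ> chart_inv \<kappa>))"

definition smooth_map ::
  "('a::topological_space, 'e::euclidean_space) atlas \<Rightarrow>
   ('b::topological_space, 'n::euclidean_space) atlas \<Rightarrow> ('a \<Rightarrow> 'b) \<Rightarrow> bool" where
  "smooth_map A A' \<psi> \<longleftrightarrow>
     continuous_on (carrier_of A) \<psi> \<and> \<psi> ` carrier_of A \<subseteq> carrier_of A' \<and>
     (\<forall>\<kappa>\<in>A. \<forall>\<kappa>'\<in>A'.
        smooth_on (snd \<kappa> ` {p \<in> fst \<kappa>. \<psi> p \<in> fst \<kappa>'}) (snd \<kappa>' \<circ> \<psi> \<circ> chart_inv \<kappa>))"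

definition prod_chart :: "('a, 'e) chart \<Rightarrow> ('b, 'f) chart \<Rightarrow> ('a \<times> 'b, 'e \<times> 'f) chart" where
  "prod_chart \<kappa> \<kappa>' = (fst \<kappa> \<times> fst \<kappa>', map_prod (snd \<kappa>) (snd \<kappa>'))"

definition prod_atlas :: "('a, 'e) atlas \<Rightarrow> ('b, 'f) atlas \<Rightarrow> ('a \<times> 'b, 'e \<times> 'f) atlas" where
  "prod_atlas A A' = {prod_chart \<kappa> \<kappa>' | \<kappa> \<kappa>'. \<kappa> \<in> A \<and> \<kappa>' \<in> A'}"

section \<open>Tensors in charts\<close>

text \<open>
  A tangent vector at p is represented by its components in 'e with respect to a chart around p,
  and a vector field by its component function. The derivative below is that of a function Y of
  manifold points, at p, in the direction with components u in the chart; for real-valued Y it is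
  the action u(Y) of the tangent vector u.
\<close>
definition dir_deriv ::
  "('a, 'e::euclidean_space) chart \<Rightarrow> ('a \<Rightarrow> 'v::real_normed_vector) \<Rightarrow> 'a \<Rightarrow> 'e \<Rightarrow> 'v" where
  "dir_deriv \<kappa> Y p u = frechet_derivative (Y \<circ> chart_inv \<kappa>) (at (snd \<kappa> p)) u"

definition differential ::
  "('a, 'e::euclidean_space) chart \<Rightarrow> ('b, 'n::euclidean_space) chart \<Rightarrow> ('a \<Rightarrow> 'b) \<Rightarrow> 'a \<Rightarrow> 'e \<Rightarrow> 'n"
  where "differential \<kappa> \<kappa>' \<psi> p u = dir_deriv \<kappa> (snd \<kappa>' \<circ> \<psi>) p u"

abbreviation chart_change ::
  "('a, 'e::euclidean_space) chart \<Rightarrow> ('a, 'e) chart \<Rightarrow> 'a \<Rightarrow> 'e \<Rightarrow> 'e" where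
  "chart_change \<kappa> \<kappa>' \<equiv> differential \<kappa> \<kappa>' (\<lambda>q. q)"

text \<open>
  A metric assigns to a chart and a point of its domain the bilinear form on components; the
  forms in different charts are related by the tensor transformation law. Values outside the
  atlas or outside the domain of the chart are irrelevant.
\<close>
type_synonym ('a, 'e) metric = "('a, 'e) chart \<Rightarrow> 'a \<Rightarrow> 'e \<Rightarrow> 'e \<Rightarrow> real"

definition riemannian_manifold ::
  "('a::{t2_space,second_countable_topology}, 'e::euclidean_space) atlas \<Rightarrow> ('a, 'e) metric \<Rightarrow> bool"
  where
  "riemannian_manifold A g \<longleftrightarrow> smooth_atlas A \<and>
     (\<forall>\<kappa>\<in>A. \<forall>p\<in>fst \<kappa>. bilinear (g \<kappa> p) \<and> (\<forall>u v. g \<kappa> p u v = g \<kappa> p v u) \<and>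
        (\<forall>u. u \<noteq> 0 \<longrightarrow> g \<kappa> p u u > 0)) \<and>
     (\<forall>\<kappa>\<in>A. \<forall>u v. smooth_on (snd \<kappa> ` fst \<kappa>) (\<lambda>x. g \<kappa> (chart_inv \<kappa> x) u v)) \<and>
     (\<forall>\<kappa>\<in>A. \<forall>\<kappa>'\<in>A. \<forall>p\<in>fst \<kappa> \<inter> fst \<kappa>'. \<forall>u v.
        g \<kappa> p u v = g \<kappa>' p (chart_change \<kappa> \<kappa>' p u) (chart_change \<kappa> \<kappa>' p v))"

text \<open>The metric \<open>g\<^sub>B + f\<^sup>2 g\<^sub>F\<close> on the product.\<close>
definition warped_product_metric ::
  "('b, 'e::euclidean_space) atlas \<Rightarrow> ('b, 'e) metric \<Rightarrow>
   ('c, 'f::euclidean_space) atlas \<Rightarrow> ('c, 'f) metric \<Rightarrow>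
   ('b \<Rightarrow> real) \<Rightarrow> ('b \<times> 'c, 'e \<times> 'f) metric \<Rightarrow> bool" where
  "warped_product_metric B gB F gF f g \<longleftrightarrow>
     (\<forall>\<kappa>B\<in>B. \<forall>\<kappa>F\<in>F. \<forall>b\<in>fst \<kappa>B. \<forall>x\<in>fst \<kappa>F. \<forall>u v.
        g (prod_chart \<kappa>B \<kappa>F) (b, x) u v =
          gB \<kappa>B b (fst u) (fst v) + (f b)\<^sup>2 * gF \<kappa>F x (snd u) (snd v))"

section \<open>Levi-Civita connection, curvature, Laplacian\<close>

text \<open>
  The Christoffel form at p, characterised as the unique symmetric (torsion-free) and metric
  connection form.
\<close>
definition levi_civita_form ::
  "('a, 'e::euclidean_space) chart \<Rightarrow> ('a, 'e) metric \<Rightarrow> 'a \<Rightarrow> 'e \<Rightarrow> 'e \<Rightarrow> 'e" where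
  "levi_civita_form \<kappa> g p = (THE \<Gamma>. bilinear \<Gamma> \<and> (\<forall>u v. \<Gamma> u v = \<Gamma> v u) \<and>
     (\<forall>u v w. dir_deriv \<kappa> (\<lambda>q. g \<kappa> q v w) p u = g \<kappa> p (\<Gamma> u v) w + g \<kappa> p v (\<Gamma> u w)))"

definition nabla ::
  "('a, 'e::euclidean_space) chart \<Rightarrow> ('a, 'e) metric \<Rightarrow> 'a \<Rightarrow> 'e \<Rightarrow> ('a \<Rightarrow> 'e) \<Rightarrow> 'e" where
  "nabla \<kappa> g p u Y = dir_deriv \<kappa> Y p u + levi_civita_form \<kappa> g p u (Y p)"

text \<open>
  Vectors are extended to fields with constant components; such fields commute, so there is no
  bracket term in \<open>R(X,Y)Z = \<nabla>\<^sub>X\<nabla>\<^sub>Y Z - \<nabla>\<^sub>Y\<nabla>\<^sub>X Z - \<nabla>\<^bsub>[X,Y]\<^esub> Z\<close>.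
\<close>
definition curvature ::
  "('a, 'e::euclidean_space) chart \<Rightarrow> ('a, 'e) metric \<Rightarrow> 'a \<Rightarrow> 'e \<Rightarrow> 'e \<Rightarrow> 'e \<Rightarrow> 'e" where
  "curvature \<kappa> g p u v w =
     nabla \<kappa> g p u (\<lambda>q. nabla \<kappa> g q v (\<lambda>_. w)) - nabla \<kappa> g p v (\<lambda>q. nabla \<kappa> g q u (\<lambda>_. w))"

definition sectional_curvature ::
  "('a, 'e::euclidean_space) chart \<Rightarrow> ('a, 'e) metric \<Rightarrow> 'a \<Rightarrow> 'e \<Rightarrow> 'e \<Rightarrow> real" where
  "sectional_curvature \<kappa> g p u v = g \<kappa> p (curvature \<kappa> g p u v v) u /
     (g \<kappa> p u u * g \<kappa> p v v - (g \<kappa> p u v)\<^sup>2)"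

text \<open>An orthonormal family \<open>e 0, \<dots>, e (DIM('e) - 1)\<close>; by cardinality it is a basis.\<close>
definition orthonormal_basis ::
  "('e::euclidean_space \<Rightarrow> 'e \<Rightarrow> real) \<Rightarrow> (nat \<Rightarrow> 'e) \<Rightarrow> bool" where
  "orthonormal_basis G e \<longleftrightarrow>
     (\<forall>i<DIM('e). \<forall>j<DIM('e). G (e i) (e j) = (if i = j then 1 else 0))"

definition local_orthonormal_frame ::
  "('a::topological_space, 'e::euclidean_space) chart \<Rightarrow> ('a, 'e) metric \<Rightarrow> 'a \<Rightarrow>
   (nat \<Rightarrow> 'a \<Rightarrow> 'e) \<Rightarrow> bool" where
  "local_orthonormal_frame \<kappa> g p v \<longleftrightarrow> (\<exists>N. open N \<and> p \<in> N \<and> N \<subseteq> fst \<kappa> \<and>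
     (\<forall>i<DIM('e). smooth_on (snd \<kappa> ` N) (v i \<circ> chart_inv \<kappa>)) \<and>
     (\<forall>q\<in>N. orthonormal_basis (g \<kappa> q) (\<lambda>i. v i q)))"

text \<open>
  The Laplacian of a Riemannian manifold, with the sign
  \<open>\<triangle>f = \<Sum>\<^sub>i ((\<nabla>\<^bsub>v\<^sub>i\<^esub> v\<^sub>i) f - v\<^sub>i v\<^sub>i f)\<close>; the value is the same for all local orthonormal frames.
  For a warped product this is used for the warping function as a function on the base
  \<open>(B, g\<^sub>B)\<close>: the sum of the sectional curvatures of the planes spanned by a unit vertical
  vector and an orthonormal basis of the horizontal space is \<open>\<triangle>f / f\<close> for the Laplacian of the
  base, not for the Laplacian of the total space.
\<close>
definition laplacian ::
  "('a::topological_space, 'e::euclidean_space) chart \<Rightarrow> ('a, 'e) metric \<Rightarrow> ('a \<Rightarrow> real) \<Rightarrow> 'a \<Rightarrow> real"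
  where
  "laplacian \<kappa> g f p = (THE r. \<exists>v. local_orthonormal_frame \<kappa> g p v \<and>
     r = (\<Sum>i<DIM('e). dir_deriv \<kappa> f p (nabla \<kappa> g p (v i p) (v i)) -
                        dir_deriv \<kappa> (\<lambda>q. dir_deriv \<kappa> f q (v i q)) p (v i p)))"

section \<open>Complex space forms\<close>

text \<open>A (1,1)-tensor field, in components with respect to charts.\<close>
type_synonym ('a, 'e) endo_field = "('a, 'e) chart \<Rightarrow> 'a \<Rightarrow> 'e \<Rightarrow> 'e"

definition almost_complex_structure ::
  "('a, 'e::euclidean_space) atlas \<Rightarrow> ('a, 'e) endo_field \<Rightarrow> bool" where
  "almost_complex_structure A J \<longleftrightarrow>
     (\<forall>\<kappa>\<in>A. \<forall>p\<in>fst \<kappa>. linear (J \<kappa> p) \<and> (\<forall>u. J \<kappa> p (J \<kappa> p u) = - u)) \<and>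
     (\<forall>\<kappa>\<in>A. \<forall>u. smooth_on (snd \<kappa> ` fst \<kappa>) (\<lambda>x. J \<kappa> (chart_inv \<kappa> x) u)) \<and>
     (\<forall>\<kappa>\<in>A. \<forall>\<kappa>'\<in>A. \<forall>p\<in>fst \<kappa> \<inter> fst \<kappa>'. \<forall>u.
        chart_change \<kappa> \<kappa>' p (J \<kappa> p u) = J \<kappa>' p (chart_change \<kappa> \<kappa>' p u))"

text \<open>The last clause is \<open>(\<nabla>\<^sub>u J) v = 0\<close>, i.e. J is parallel.\<close>
definition kaehler_manifold ::
  "('a::{t2_space,second_countable_topology}, 'e::euclidean_space) atlas \<Rightarrow> ('a, 'e) metric \<Rightarrow>
   ('a, 'e) endo_field \<Rightarrow> bool" where
  "kaehler_manifold A g J \<longleftrightarrow> riemannian_manifold A g \<and> almost_complex_structure A J \<and>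
     (\<forall>\<kappa>\<in>A. \<forall>p\<in>fst \<kappa>. \<forall>u v. g \<kappa> p (J \<kappa> p u) (J \<kappa> p v) = g \<kappa> p u v) \<and>
     (\<forall>\<kappa>\<in>A. \<forall>p\<in>fst \<kappa>. \<forall>u v.
        nabla \<kappa> g p u (\<lambda>q. J \<kappa> q v) - J \<kappa> p (nabla \<kappa> g p u (\<lambda>_. v)) = 0)"

definition complex_space_form ::
  "('a::{t2_space,second_countable_topology}, 'e::euclidean_space) atlas \<Rightarrow> ('a, 'e) metric \<Rightarrow>
   ('a, 'e) endo_field \<Rightarrow> real \<Rightarrow> bool" where
  "complex_space_form A g J c \<longleftrightarrow> kaehler_manifold A g J \<and>
     (\<forall>\<kappa>\<in>A. \<forall>p\<in>fst \<kappa>. \<forall>u. u \<noteq> 0 \<longrightarrow> sectional_curvature \<kappa> g p u (J \<kappa> p u) = c)"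

section \<open>Isometric immersions\<close>

definition isometric_immersion ::
  "('a::topological_space, 'e::euclidean_space) atlas \<Rightarrow> ('a, 'e) metric \<Rightarrow>
   ('b::topological_space, 'n::euclidean_space) atlas \<Rightarrow> ('b, 'n) metric \<Rightarrow> ('a \<Rightarrow> 'b) \<Rightarrow> bool" where
  "isometric_immersion A g A' g' \<psi> \<longleftrightarrow> smooth_map A A' \<psi> \<and>
     (\<forall>\<kappa>\<in>A. \<forall>\<kappa>'\<in>A'. \<forall>p\<in>fst \<kappa>. \<psi> p \<in> fst \<kappa>' \<longrightarrow>
        inj (differential \<kappa> \<kappa>' \<psi> p) \<and>
        (\<forall>u v. g \<kappa> p u v = g' \<kappa>' (\<psi> p) (differential \<kappa> \<kappa>' \<psi> p u) (differential \<kappa> \<kappa>' \<psi> p v)))"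

text \<open>
  The Levi-Civita covariant derivative of the ambient manifold, along \<open>\<psi>\<close>: W is the component
  function, in the ambient chart, of a vector field along \<open>\<psi>\<close>.
\<close>
definition nabla_along ::
  "('a, 'e::euclidean_space) chart \<Rightarrow> ('b, 'n::euclidean_space) chart \<Rightarrow> ('b, 'n) metric \<Rightarrow>
   ('a \<Rightarrow> 'b) \<Rightarrow> 'a \<Rightarrow> 'e \<Rightarrow> ('a \<Rightarrow> 'n) \<Rightarrow> 'n" where
  "nabla_along \<kappa> \<kappa>' g' \<psi> p u W = dir_deriv \<kappa> W p u +
     levi_civita_form \<kappa>' g' (\<psi> p) (differential \<kappa> \<kappa>' \<psi> p u) (W p)"

text \<open>
  Gauss formula \<open>h(X,Y) = \<nabla>'\<^sub>X (\<psi>\<^sub>* Y) - \<psi>\<^sub>* (\<nabla>\<^sub>X Y)\<close>, with Y the field with constant components v.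
\<close>
definition second_fundamental_form ::
  "('a, 'e::euclidean_space) chart \<Rightarrow> ('a, 'e) metric \<Rightarrow> ('b, 'n::euclidean_space) chart \<Rightarrow>
   ('b, 'n) metric \<Rightarrow> ('a \<Rightarrow> 'b) \<Rightarrow> 'a \<Rightarrow> 'e \<Rightarrow> 'e \<Rightarrow> 'n" where
  "second_fundamental_form \<kappa> g \<kappa>' g' \<psi> p u v =
     nabla_along \<kappa> \<kappa>' g' \<psi> p u (\<lambda>q. differential \<kappa> \<kappa>' \<psi> q v) -
     differential \<kappa> \<kappa>' \<psi> p (nabla \<kappa> g p u (\<lambda>_. v))"

text \<open>The following two values are the same for all orthonormal bases of the tangent space.\<close>
definition mean_curvature_vector ::
  "('a, 'e::euclidean_space) chart \<Rightarrow> ('a, 'e) metric \<Rightarrow> ('b, 'n::euclidean_space) chart \<Rightarrow>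
   ('b, 'n) metric \<Rightarrow> ('a \<Rightarrow> 'b) \<Rightarrow> 'a \<Rightarrow> 'n" where
  "mean_curvature_vector \<kappa> g \<kappa>' g' \<psi> p = (THE H. \<exists>e. orthonormal_basis (g \<kappa> p) e \<and>
     H = (1 / real DIM('e)) *\<^sub>R
           (\<Sum>i<DIM('e). second_fundamental_form \<kappa> g \<kappa>' g' \<psi> p (e i) (e i)))"

definition second_fundamental_form_norm2 ::
  "('a, 'e::euclidean_space) chart \<Rightarrow> ('a, 'e) metric \<Rightarrow> ('b, 'n::euclidean_space) chart \<Rightarrow>
   ('b, 'n) metric \<Rightarrow> ('a \<Rightarrow> 'b) \<Rightarrow> 'a \<Rightarrow> real" where
  "second_fundamental_form_norm2 \<kappa> g \<kappa>' g' \<psi> p = (THE r. \<exists>e. orthonormal_basis (g \<kappa> p) e \<and>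
     r = (\<Sum>i<DIM('e). \<Sum>j<DIM('e).
            g' \<kappa>' (\<psi> p) (second_fundamental_form \<kappa> g \<kappa>' g' \<psi> p (e i) (e j))
                       (second_fundamental_form \<kappa> g \<kappa>' g' \<psi> p (e i) (e j))))"

definition mean_curvature_norm2 ::
  "('a, 'e::euclidean_space) chart \<Rightarrow> ('a, 'e) metric \<Rightarrow> ('b, 'n::euclidean_space) chart \<Rightarrow>
   ('b, 'n) metric \<Rightarrow> ('a \<Rightarrow> 'b) \<Rightarrow> 'a \<Rightarrow> real" where
  "mean_curvature_norm2 \<kappa> g \<kappa>' g' \<psi> p = g' \<kappa>' (\<psi> p)
     (mean_curvature_vector \<kappa> g \<kappa>' g' \<psi> p) (mean_curvature_vector \<kappa> g \<kappa>' g' \<psi> p)"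

end

theory Submission
  imports Defs
begin

text \<open>
  For a horizontal unit vector a and a vertical unit vector w of the warped product, the sectional
  curvature of their plane is \<open>- Hess f (a,a) / f\<close>, so \<open>\<triangle>f / f\<close> is the sum of the sectional
  curvatures of the planes spanned by a fixed w and an orthonormal horizontal basis. By the Gauss
  equation each of them equals \<open>K + g(h(a,a), h(w,w)) - |h(a,w)|\<^sup>2\<close>, where K, the sectional curvature
  of the complex space form, is \<open>c/4 (1 + 3 g(a,Jw)\<^sup>2)\<close> and thus lies between \<open>c/4\<close> and c. For the
  lower bound, the Cauchy--Schwarz inequality for the \<open>m - 1\<close> vectors \<open>h(a,a) + h(w,w)\<close> and
  \<open>h(e\<^sub>k,e\<^sub>k)\<close>, with \<open>e\<^sub>k\<close> the other basis vectors, bounds the h-terms of each plane. For the upper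
  bound, one sums over w as well and uses \<open>4 g(x,y) \<le> |x + y|\<^sup>2\<close> for the traces x and y of h over the
  horizontal and the vertical basis.
\<close>

section \<open>Calculus of smooth functions\<close>

text \<open>The connection, the Laplacian, the mean curvature vector and |h|^2 are given by definite
  descriptions, so each needs existence and uniqueness: a Gram--Schmidt frame supplies the first,
  the Koszul formula or the invariance of traces the second. The curvature tensor of M itself is
  never formed: a horizontal u and a vertical w with constant components are orthogonal and g(u,u)
  does not vary along w, so the intrinsic part of the Gauss equation collapses to one second
  derivative of g(w,w) and products of Christoffel terms, which together give the Hessian of f. The
  two bounds use the freedom in w differently. The lower one takes a single w; each of the m1 planes
  is charged with half of all of |h|^2, whence m1/2. The upper one needs all m2 vectors w, because
  only the double sum produces the traces of h; its 1/(4 m2) is the 1/4 of the inequality for traces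
  divided by m2. The formula for K has to be derived by polarisation, since a complex space form is
  given by its holomorphic sectional curvature and not by its curvature tensor.\<close>

abbreviation dd :: "'a::real_normed_vector \<Rightarrow> ('a \<Rightarrow> 'b::real_normed_vector) \<Rightarrow> 'a \<Rightarrow> 'b" where
  "dd u f x \<equiv> frechet_derivative f (at x) u"

lemma dd_eqI: "(f has_derivative f') (at x) \<Longrightarrow> dd u f x = f' u"
  by (metis frechet_derivative_at)

text \<open>\<open>frechet_derivative\<close> is a choice among the derivatives at x, and f and g
  have the same ones, so the equation holds even where there are none.\<close>

lemma dd_cong_open:
  assumes "open S" "x \<in> S" "\<And>y. y \<in> S \<Longrightarrow> f y = g y"
  shows "dd u f x = dd u g x"
proof -
  have "(f has_derivative D) (at x) \<longleftrightarrow> (g has_derivative D) (at x)" for D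
    using assms has_derivative_transform_within_open by metis
  then show ?thesis unfolding frechet_derivative_def by simp
qed

lemma differentiable_cong_open:
  assumes "open S" "x \<in> S" "\<And>y. y \<in> S \<Longrightarrow> f y = g y" "f differentiable (at x)"
  shows "g differentiable (at x)"
  using assms unfolding differentiable_def by (metis has_derivative_transform_within_open)

lemma Ck_on_cong:
  assumes "open S" "\<And>x. x \<in> S \<Longrightarrow> f x = g x"
  shows "Ck_on k S f \<longleftrightarrow> Ck_on k S g"
  using assms(2)
proof (induction k arbitrary: f g)
  case 0
  then show ?case by (simp cong: continuous_on_cong)
next
  case (Suc k)
  have "f differentiable (at x) \<longleftrightarrow> g differentiable (at x)" if "x \<in> S" for x
    using differentiable_cong_open[OF assms(1) that] Suc.prems by metis
  moreover have "Ck_on k S (dd v f) \<longleftrightarrow> Ck_on k S (dd v g)" for v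
    by (rule Suc.IH) (use dd_cong_open[OF assms(1)] Suc.prems in blast)
  ultimately show ?case by simp
qed

text \<open>The common pattern of the closure lemmas below: a formula for the derivative, valid on S
  only, that lies one level down. Openness of S transfers the level to
  \<open>frechet_derivative\<close>, to which \<open>Ck_on\<close> refers.\<close>

lemma Ck_on_SucI:
  assumes "open S" "\<And>x. x \<in> S \<Longrightarrow> (f has_derivative (\<lambda>v. f' v x)) (at x)" "\<And>v. Ck_on k S (f' v)"
  shows "Ck_on (Suc k) S f"
proof -
  have "Ck_on k S (dd v f)" for v
    using Ck_on_cong[OF assms(1), of "dd v f" "f' v" k] dd_eqI[OF assms(2)] assms(3) by simp
  then show ?thesis using assms(2) by (auto intro: differentiableI)
qed

lemma Ck_on_SucD: "Ck_on (Suc k) S f \<Longrightarrow> Ck_on k S f"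
proof (induction k arbitrary: f)
  case 0
  then show ?case
    by (auto intro!: continuous_at_imp_continuous_on differentiable_imp_continuous_within)
next
  case (Suc k)
  then show ?case by (metis Ck_on.simps(2))
qed

lemma Ck_on_const: "Ck_on k S (\<lambda>_. c)"
  by (induction k arbitrary: c) auto

lemma Ck_on_add:
  assumes "open S" "Ck_on k S f" "Ck_on k S g"
  shows "Ck_on k S (\<lambda>x. f x + g x)"
  using assms(2,3)
proof (induction k arbitrary: f g)
  case 0
  then show ?case by (simp add: continuous_on_add)
next
  case (Suc k)
  have "((\<lambda>x. f x + g x) has_derivative (\<lambda>v. dd v f x + dd v g x)) (at x)" if "x \<in> S" for x
    using Suc.prems that by (auto intro!: has_derivative_add simp: frechet_derivative_works)
  moreover have "Ck_on k S (\<lambda>x. dd v f x + dd v g x)" for v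
    using Suc by simp
  ultimately show ?case by (rule Ck_on_SucI[OF assms(1)])
qed

lemma (in bounded_linear) Ck_on_comp:
  assumes "open S" "Ck_on k S g"
  shows "Ck_on k S (\<lambda>x. f (g x))"
  using assms(2)
proof (induction k arbitrary: g)
  case 0
  then show ?case by (simp add: continuous_on)
next
  case (Suc k)
  have D: "((\<lambda>x. f (g x)) has_derivative (\<lambda>v. f (dd v g x))) (at x)" if "x \<in> S" for x
    using Suc.prems that by (intro has_derivative) (simp add: frechet_derivative_works)
  have "Ck_on k S (\<lambda>x. f (dd v g x))" for v
    using Suc by simp
  with D show ?case by (rule Ck_on_SucI[OF assms(1)])
qed

lemma (in bounded_bilinear) Ck_on_prod:
  assumes "open S" "Ck_on k S f" "Ck_on k S g"
  shows "Ck_on k S (\<lambda>x. prod (f x) (g x))"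
  using assms(2,3)
proof (induction k arbitrary: f g)
  case 0
  then show ?case by (simp add: continuous_on)
next
  case (Suc k)
  have D: "((\<lambda>x. prod (f x) (g x)) has_derivative
      (\<lambda>v. prod (f x) (dd v g x) + prod (dd v f x) (g x))) (at x)" if "x \<in> S" for x
    using Suc.prems that by (intro FDERIV) (simp_all add: frechet_derivative_works)
  \<comment> \<open>In each term of the product rule one factor stays undifferentiated and must be
    lowered to level k.\<close>
  have "Ck_on k S f" "Ck_on k S g"
    using Suc.prems Ck_on_SucD by blast+
  then have "Ck_on k S (\<lambda>x. prod (f x) (dd v g x) + prod (dd v f x) (g x))" for v
    using Suc.prems by (intro Ck_on_add[OF assms(1)] Suc.IH) auto
  with D show ?case by (rule Ck_on_SucI[OF assms(1)])
qed

text \<open>An arbitrary exponent closes the induction, since differentiation replaces r by r - 1.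
  The case r = -1/2 normalises vectors in the Gram--Schmidt process.\<close>

lemma Ck_on_powr:
  fixes f :: "'a::real_normed_vector \<Rightarrow> real"
  assumes "open S" "Ck_on k S f" "\<And>x. x \<in> S \<Longrightarrow> f x > 0"
  shows "Ck_on k S (\<lambda>x. f x powr r)"
  using assms(2)
proof (induction k arbitrary: r)
  case 0
  show ?case using 0 assms(3) by (force intro!: continuous_on_powr)
next
  case (Suc k)
  have D: "((\<lambda>x. f x powr r) has_derivative (\<lambda>v. (r * f x powr (r - 1)) * dd v f x)) (at x)"
    if "x \<in> S" for x
  proof -
    have 1: "((\<lambda>y. y powr r) has_derivative (*) (r * f x powr (r - 1))) (at (f x))"
      using has_real_derivative_powr[OF assms(3)[OF that]] by (simp add: has_field_derivative_def)
    have 2: "(f has_derivative (\<lambda>v. dd v f x)) (at x)"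
      using Suc.prems that by (simp add: frechet_derivative_works)
    show ?thesis using has_derivative_compose[OF 2 1] .
  qed
  have "Ck_on k S f" using Suc.prems Ck_on_SucD by blast
  then have "Ck_on k S (\<lambda>x. (r * f x powr (r - 1)) * dd v f x)" for v
    using Suc by (intro bounded_bilinear.Ck_on_prod[OF bounded_bilinear_mult assms(1)] Ck_on_const) auto
  with D show ?case by (rule Ck_on_SucI[OF assms(1)])
qed

lemma smooth_on_cong:
  "open S \<Longrightarrow> (\<And>x. x \<in> S \<Longrightarrow> f x = g x) \<Longrightarrow> smooth_on S f \<longleftrightarrow> smooth_on S g"
  using Ck_on_cong unfolding smooth_on_def by blast

lemma smooth_on_dd: "smooth_on S f \<Longrightarrow> smooth_on S (dd v f)"
  unfolding smooth_on_def by (metis Ck_on.simps(2))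

lemma smooth_on_differentiable: "smooth_on S f \<Longrightarrow> x \<in> S \<Longrightarrow> f differentiable (at x)"
  unfolding smooth_on_def by (metis Ck_on.simps(2))

lemma smooth_on_has_derivative:
  "smooth_on S f \<Longrightarrow> x \<in> S \<Longrightarrow> (f has_derivative (\<lambda>v. dd v f x)) (at x)"
  using smooth_on_differentiable frechet_derivative_works by blast

lemma smooth_on_const: "smooth_on S (\<lambda>_. c)"
  by (simp add: smooth_on_def Ck_on_const)

lemma smooth_on_add:
  "open S \<Longrightarrow> smooth_on S f \<Longrightarrow> smooth_on S g \<Longrightarrow> smooth_on S (\<lambda>x. f x + g x)"
  by (simp add: smooth_on_def Ck_on_add)

lemma smooth_on_sum:
  assumes "open S" "\<And>i. i \<in> I \<Longrightarrow> smooth_on S (f i)"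
  shows "smooth_on S (\<lambda>x. \<Sum>i\<in>I. f i x)"
  using assms(2) by (induction I rule: infinite_finite_induct)
    (auto intro: smooth_on_const smooth_on_add[OF assms(1)])

lemma smooth_on_mult:
  fixes f g :: "'a::real_normed_vector \<Rightarrow> real"
  shows "open S \<Longrightarrow> smooth_on S f \<Longrightarrow> smooth_on S g \<Longrightarrow> smooth_on S (\<lambda>x. f x * g x)"
  by (simp add: smooth_on_def bounded_bilinear.Ck_on_prod[OF bounded_bilinear_mult])

lemma smooth_on_scaleR:
  "open S \<Longrightarrow> smooth_on S f \<Longrightarrow> smooth_on S g \<Longrightarrow> smooth_on S (\<lambda>x. f x *\<^sub>R g x)"
  by (simp add: smooth_on_def bounded_bilinear.Ck_on_prod[OF bounded_bilinear_scaleR])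

lemma smooth_on_diff:
  assumes "open S" "smooth_on S f" "smooth_on S g" shows "smooth_on S (\<lambda>x. f x - g x)"
  using smooth_on_add[OF assms(1,2) smooth_on_scaleR[OF assms(1) smooth_on_const[of S "-1"] assms(3)]]
  by simp

lemma smooth_on_inner_left:
  "open S \<Longrightarrow> smooth_on S f \<Longrightarrow> smooth_on S (\<lambda>x. f x \<bullet> i)"
  by (simp add: smooth_on_def bounded_linear.Ck_on_comp[OF bounded_linear_inner_left])

lemma smooth_on_powr:
  fixes f :: "'a::real_normed_vector \<Rightarrow> real"
  shows "open S \<Longrightarrow> smooth_on S f \<Longrightarrow> (\<And>x. x \<in> S \<Longrightarrow> f x > 0) \<Longrightarrow> smooth_on S (\<lambda>x. f x powr r)"
  by (simp add: smooth_on_def Ck_on_powr)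

section \<open>Symmetry of second derivatives\<close>

lemma second_difference_mean_value:
  fixes f :: "'a::real_normed_vector \<Rightarrow> real"
  assumes f: "\<And>x. x \<in> S \<Longrightarrow> f differentiable (at x)"
    and f': "\<And>x. x \<in> S \<Longrightarrow> dd u f differentiable (at x)"
    and s: "s > 0"
    and S: "\<And>a b. \<lbrakk>0 \<le> a; a \<le> s; 0 \<le> b; b \<le> s\<rbrakk> \<Longrightarrow> x + a *\<^sub>R u + b *\<^sub>R v \<in> S"
  obtains a b where "0 < a" "a < s" "0 < b" "b < s"
    "f (x + s *\<^sub>R u + s *\<^sub>R v) - f (x + s *\<^sub>R u) - f (x + s *\<^sub>R v) + f x =
      s\<^sup>2 * dd v (dd u f) (x + a *\<^sub>R u + b *\<^sub>R v)"
proof -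
  have line: "((\<lambda>t. h (y + t *\<^sub>R w)) has_real_derivative dd w h (y + t *\<^sub>R w)) (at t)"
    if "h differentiable (at (y + t *\<^sub>R w))" for h :: "'a \<Rightarrow> real" and y w t
  proof -
    have 1: "((\<lambda>t. y + t *\<^sub>R w) has_derivative (\<lambda>t. t *\<^sub>R w)) (at t)"
      by (auto intro!: derivative_eq_intros)
    have 2: "(h has_derivative (\<lambda>v. dd v h (y + t *\<^sub>R w))) (at (y + t *\<^sub>R w))"
      using that frechet_derivative_works by blast
    have "((\<lambda>t. h (y + t *\<^sub>R w)) has_derivative (\<lambda>r. dd (r *\<^sub>R w) h (y + t *\<^sub>R w))) (at t)"
      using has_derivative_compose[OF 1 2] .
    moreover have "(\<lambda>r. dd (r *\<^sub>R w) h (y + t *\<^sub>R w)) = (*) (dd w h (y + t *\<^sub>R w))"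
      using linear_cmul[OF linear_frechet_derivative[OF that]] by (auto simp: mult.commute)
    ultimately show ?thesis by (simp add: has_field_derivative_def)
  qed
  \<comment> \<open>The mean value theorem is applied first along u, to the increment of f by s v,
    and then along v, to \<open>dd u f\<close>. The redex tells \<open>MVT2\<close> which function
    is meant.\<close>
  have "\<exists>a. a > 0 \<and> a < s \<and>
     (\<lambda>a. f ((x + s *\<^sub>R v) + a *\<^sub>R u) - f (x + a *\<^sub>R u)) s - (\<lambda>a. f ((x + s *\<^sub>R v) + a *\<^sub>R u) - f (x + a *\<^sub>R u)) 0 =
      (s - 0) * (dd u f ((x + s *\<^sub>R v) + a *\<^sub>R u) - dd u f (x + a *\<^sub>R u))"
    using s
  proof (rule MVT2)
    fix a assume "0 \<le> a" "a \<le> s"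
    then show "((\<lambda>a. f ((x + s *\<^sub>R v) + a *\<^sub>R u) - f (x + a *\<^sub>R u)) has_real_derivative
        (dd u f ((x + s *\<^sub>R v) + a *\<^sub>R u) - dd u f (x + a *\<^sub>R u))) (at a)"
      using S[of a s] S[of a 0] s by (intro DERIV_diff line f) (auto simp: algebra_simps)
  qed
  then obtain a where a: "0 < a" "a < s" and
    1: "f (x + s *\<^sub>R v + s *\<^sub>R u) - f (x + s *\<^sub>R u) - (f (x + s *\<^sub>R v) - f x) =
      s * (dd u f ((x + s *\<^sub>R v) + a *\<^sub>R u) - dd u f (x + a *\<^sub>R u))" by auto
  have "\<exists>b. b > 0 \<and> b < s \<and>
     dd u f ((x + a *\<^sub>R u) + s *\<^sub>R v) - dd u f ((x + a *\<^sub>R u) + 0 *\<^sub>R v) =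
      (s - 0) * dd v (dd u f) ((x + a *\<^sub>R u) + b *\<^sub>R v)"
    using s
  proof (rule MVT2)
    fix b assume "0 \<le> b" "b \<le> s"
    then show "((\<lambda>b. dd u f ((x + a *\<^sub>R u) + b *\<^sub>R v)) has_real_derivative
        dd v (dd u f) ((x + a *\<^sub>R u) + b *\<^sub>R v)) (at b)"
      using S[of a b] a by (intro line f') auto
  qed
  then obtain b where b: "0 < b" "b < s" and
    2: "dd u f ((x + a *\<^sub>R u) + s *\<^sub>R v) - dd u f (x + a *\<^sub>R u) =
      s * dd v (dd u f) ((x + a *\<^sub>R u) + b *\<^sub>R v)" by auto
  show ?thesis
    using that[OF a b] 1 2 by (simp add: algebra_simps power2_eq_square)
qed

text \<open>The second difference of f over a small parallelogram at x is symmetric in u and v, and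
  equals s^2 times either mixed derivative at some point of the parallelogram. Both mixed
  derivatives are continuous at x, so they cannot differ there.\<close>

lemma dd_commute_real:
  fixes f :: "'a::real_normed_vector \<Rightarrow> real"
  assumes S: "open S" and f: "smooth_on S f" and x: "x \<in> S"
  shows "dd u (dd v f) x = dd v (dd u f) x"
proof (rule ccontr)
  assume ne: "dd u (dd v f) x \<noteq> dd v (dd u f) x"
  \<comment> \<open>Half the supposed gap: numbers within e of the two mixed derivatives cannot
    coincide.\<close>
  define e where "e = \<bar>dd u (dd v f) x - dd v (dd u f) x\<bar> / 2"
  have e: "e > 0" using ne by (simp add: e_def)
  have cont: "\<exists>d>0. \<forall>y. dist y x < d \<longrightarrow> dist (h y) (h x) < e" if "smooth_on S h" for h :: "'a \<Rightarrow> real"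
  proof -
    have "continuous (at x) h"
      using smooth_on_differentiable[OF that x] differentiable_imp_continuous_within by blast
    then show ?thesis using e unfolding continuous_at_eps_delta by auto
  qed
  obtain d1 where d1: "d1 > 0"
    "\<And>y. dist y x < d1 \<Longrightarrow> dist (dd u (dd v f) y) (dd u (dd v f) x) < e"
    using cont[of "dd u (dd v f)"] f smooth_on_dd by metis
  obtain d2 where d2: "d2 > 0"
    "\<And>y. dist y x < d2 \<Longrightarrow> dist (dd v (dd u f) y) (dd v (dd u f) x) < e"
    using cont[of "dd v (dd u f)"] f smooth_on_dd by metis
  obtain d3 where d3: "d3 > 0" "ball x d3 \<subseteq> S"
    using S x open_contains_ball by blast
  define d where "d = min d1 (min d2 d3)"
  have d: "d > 0" "d \<le> d1" "d \<le> d2" "d \<le> d3" using d1 d2 d3 by (auto simp: d_def)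
  \<comment> \<open>The parallelogram with sides s u and s v then lies in the ball of radius d; the
    summand 1 keeps the denominator positive for u = v = 0.\<close>
  define s where "s = d / (norm u + norm v + 1)"
  have s: "s > 0" using d by (simp add: s_def add_nonneg_pos)
  have near: "dist (x + a *\<^sub>R u' + b *\<^sub>R v') x < d"
    if "0 \<le> a" "a \<le> s" "0 \<le> b" "b \<le> s" and uv: "{u', v'} = {u, v}" for a b u' v'
  proof -
    have "norm (a *\<^sub>R u' + b *\<^sub>R v') \<le> a * norm u' + b * norm v'"
      using that norm_triangle_ineq[of "a *\<^sub>R u'" "b *\<^sub>R v'"] by simp
    also have "\<dots> \<le> s * norm u' + s * norm v'"
      using that by (intro add_mono mult_right_mono) auto
    also have "\<dots> = s * (norm u + norm v)"
      using uv by (auto simp: doubleton_eq_iff algebra_simps)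
    also have "\<dots> < s * (norm u + norm v + 1)" using s by simp
    also have "\<dots> = d"
      unfolding s_def using norm_ge_zero[of u] norm_ge_zero[of v] by (simp add: add_nonneg_eq_0_iff)
    finally show ?thesis by (simp add: dist_norm algebra_simps)
  qed
  have inS: "x + a *\<^sub>R u' + b *\<^sub>R v' \<in> S"
    if "0 \<le> a" "a \<le> s" "0 \<le> b" "b \<le> s" and uv: "{u', v'} = {u, v}" for a b u' v'
    using near[OF that] d d3 by (auto simp: dist_commute subset_iff)
  note smooth = smooth_on_differentiable[OF f] smooth_on_differentiable[OF smooth_on_dd[OF f]]
  obtain a b where ab: "0 < a" "a < s" "0 < b" "b < s" and
    1: "f (x + s *\<^sub>R u + s *\<^sub>R v) - f (x + s *\<^sub>R u) - f (x + s *\<^sub>R v) + f x =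
      s\<^sup>2 * dd v (dd u f) (x + a *\<^sub>R u + b *\<^sub>R v)"
    using second_difference_mean_value[of S f u s x v, OF smooth s inS] by blast
  obtain a' b' where ab': "0 < a'" "a' < s" "0 < b'" "b' < s" and
    2: "f (x + s *\<^sub>R v + s *\<^sub>R u) - f (x + s *\<^sub>R v) - f (x + s *\<^sub>R u) + f x =
      s\<^sup>2 * dd u (dd v f) (x + a' *\<^sub>R v + b' *\<^sub>R u)"
    using second_difference_mean_value[of S f v s x u, OF smooth s inS[OF _ _ _ _ insert_commute]] by blast
  have "s\<^sup>2 * dd v (dd u f) (x + a *\<^sub>R u + b *\<^sub>R v) = s\<^sup>2 * dd u (dd v f) (x + a' *\<^sub>R v + b' *\<^sub>R u)"
    using 1 2 by (simp add: algebra_simps)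
  then have "dd v (dd u f) (x + a *\<^sub>R u + b *\<^sub>R v) = dd u (dd v f) (x + a' *\<^sub>R v + b' *\<^sub>R u)"
    using s by simp
  moreover have "dist (dd v (dd u f) (x + a *\<^sub>R u + b *\<^sub>R v)) (dd v (dd u f) x) < e"
    using d2(2)[OF less_le_trans[OF near[of a b u v] d(3)]] ab by simp
  moreover have "dist (dd u (dd v f) (x + a' *\<^sub>R v + b' *\<^sub>R u)) (dd u (dd v f) x) < e"
    using d1(2)[OF less_le_trans[OF near[of a' b' v u] d(2)]] ab' by (simp add: insert_commute)
  ultimately show False unfolding dist_real_def e_def by argo
qed

lemma dd_inner:
  assumes "f differentiable (at x)" shows "dd u (\<lambda>y. f y \<bullet> i) x = dd u f x \<bullet> i"
  using assms by (intro dd_eqI has_derivative_inner_left) (simp add: frechet_derivative_works)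

lemma dd_commute:
  fixes f :: "'a::real_normed_vector \<Rightarrow> 'b::euclidean_space"
  assumes S: "open S" and f: "smooth_on S f" and x: "x \<in> S"
  shows "dd u (dd v f) x = dd v (dd u f) x"
proof (rule euclidean_eqI)
  fix i :: 'b
  have *: "dd u (dd v f) x \<bullet> i = dd u (dd v (\<lambda>y. f y \<bullet> i)) x" for u v
  proof -
    have "dd u (dd v f) x \<bullet> i = dd u (\<lambda>y. dd v f y \<bullet> i) x"
      using smooth_on_differentiable[OF smooth_on_dd[OF f] x] by (simp add: dd_inner)
    also have "\<dots> = dd u (dd v (\<lambda>y. f y \<bullet> i)) x"
      using smooth_on_differentiable[OF f]
      by (intro dd_cong_open[OF S x]) (simp add: dd_inner)
    finally show ?thesis .
  qed
  show "dd u (dd v f) x \<bullet> i = dd v (dd u f) x \<bullet> i"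
    unfolding * using dd_commute_real[OF S smooth_on_inner_left[OF S f] x] .
qed

lemma dd_add:
  "f differentiable (at x) \<Longrightarrow> g differentiable (at x) \<Longrightarrow> dd u (\<lambda>y. f y + g y) x = dd u f x + dd u g x"
  by (intro dd_eqI has_derivative_add) (simp_all add: frechet_derivative_works)

lemma dd_scaleR_const:
  "f differentiable (at x) \<Longrightarrow> dd u (\<lambda>y. c *\<^sub>R f y) x = c *\<^sub>R dd u f x"
  by (intro dd_eqI has_derivative_scaleR_right) (simp_all add: frechet_derivative_works)

lemma dd_linear: "f differentiable (at x) \<Longrightarrow> linear (\<lambda>u. dd u f x)"
  by (rule linear_frechet_derivative)

section \<open>Fields of linear and bilinear maps\<close>

lemma bilinearI_linear:
  "(\<And>x. linear (\<lambda>y. h x y)) \<Longrightarrow> (\<And>y. linear (\<lambda>x. h x y)) \<Longrightarrow> bilinear h"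
  unfolding bilinear_def by blast

lemma bilinear_linear_left: "bilinear h \<Longrightarrow> linear (\<lambda>x. h x y)"
  and bilinear_linear_right: "bilinear h \<Longrightarrow> linear (\<lambda>y. h x y)"
  unfolding bilinear_def by blast+

lemma bilinear_sum_left: "bilinear h \<Longrightarrow> h (\<Sum>i\<in>I. f i) y = (\<Sum>i\<in>I. h (f i) y)"
  and bilinear_sum_right: "bilinear h \<Longrightarrow> h x (\<Sum>i\<in>I. f i) = (\<Sum>i\<in>I. h x (f i))"
  using linear_sum[OF bilinear_linear_left] linear_sum[OF bilinear_linear_right] by blast+

lemma linear_euclidean_expand:
  fixes L :: "'a::euclidean_space \<Rightarrow> 'b::real_normed_vector"
  assumes "linear L"
  shows "L w = (\<Sum>i\<in>Basis. (w \<bullet> i) *\<^sub>R L i)"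
proof -
  have "L w = L (\<Sum>i\<in>Basis. (w \<bullet> i) *\<^sub>R i)" by (simp add: euclidean_representation)
  also have "\<dots> = (\<Sum>i\<in>Basis. (w \<bullet> i) *\<^sub>R L i)"
    using assms by (simp add: linear_sum linear_cmul)
  finally show ?thesis .
qed

lemma dd_linear_field:
  fixes L :: "'x::real_normed_vector \<Rightarrow> 'a::real_vector \<Rightarrow> 'b::real_normed_vector"
  assumes S: "open S" "x \<in> S" and lin: "\<And>y. y \<in> S \<Longrightarrow> linear (L y)"
    and L: "\<And>a. (\<lambda>y. L y a) differentiable (at x)"
  shows "linear (\<lambda>a. dd u (\<lambda>y. L y a) x)"
proof (rule linearI)
  fix a b :: 'a and c :: real
  have "dd u (\<lambda>y. L y (a + b)) x = dd u (\<lambda>y. L y a + L y b) x"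
    by (rule dd_cong_open[OF S]) (rule linear_add[OF lin])
  then show "dd u (\<lambda>y. L y (a + b)) x = dd u (\<lambda>y. L y a) x + dd u (\<lambda>y. L y b) x"
    by (simp add: dd_add L)
  have "dd u (\<lambda>y. L y (c *\<^sub>R a)) x = dd u (\<lambda>y. c *\<^sub>R L y a) x"
    by (rule dd_cong_open[OF S]) (rule linear_cmul[OF lin])
  then show "dd u (\<lambda>y. L y (c *\<^sub>R a)) x = c *\<^sub>R dd u (\<lambda>y. L y a) x"
    by (simp add: dd_scaleR_const L)
qed

text \<open>Differentiability is given only for the fields \<open>\<lambda>y. L y a\<close> with a
  fixed. Expanding W y in the standard basis turns L y (W y) into a finite sum of scalar multiples
  of such fields, to which the ordinary product rule applies.\<close>

lemma linear_field_has_derivative: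
  fixes L :: "'x::real_normed_vector \<Rightarrow> 'a::euclidean_space \<Rightarrow> 'b::real_normed_vector"
  assumes S: "open S" and x: "x \<in> S" and lin: "\<And>y. y \<in> S \<Longrightarrow> linear (L y)"
    and L: "\<And>a. (\<lambda>y. L y a) differentiable (at x)" and W: "W differentiable (at x)"
  shows "((\<lambda>y. L y (W y)) has_derivative
    (\<lambda>u. dd u (\<lambda>y. L y (W x)) x + L x (dd u W x))) (at x)"
proof -
  let ?D = "\<lambda>u. \<Sum>i\<in>Basis. (W x \<bullet> i) *\<^sub>R dd u (\<lambda>y. L y i) x + (dd u W x \<bullet> i) *\<^sub>R L x i"
  have LD: "((\<lambda>y. L y i) has_derivative (\<lambda>u. dd u (\<lambda>y. L y i) x)) (at x)" for i
    using L frechet_derivative_works by blast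
  have WD: "(W has_derivative (\<lambda>u. dd u W x)) (at x)"
    using W frechet_derivative_works by blast
  have "((\<lambda>y. \<Sum>i\<in>Basis. (W y \<bullet> i) *\<^sub>R L y i) has_derivative ?D) (at x)"
    by (intro has_derivative_sum has_derivative_scaleR has_derivative_inner_left WD LD)
  then have "((\<lambda>y. L y (W y)) has_derivative ?D) (at x)"
    by (rule has_derivative_transform_within_open[OF _ S x]) (metis linear_euclidean_expand lin)
  moreover have "?D u = dd u (\<lambda>y. L y (W x)) x + L x (dd u W x)" for u
  proof -
    have "((\<lambda>y. \<Sum>i\<in>Basis. (W x \<bullet> i) *\<^sub>R L y i) has_derivative
        (\<lambda>u. \<Sum>i\<in>Basis. (W x \<bullet> i) *\<^sub>R dd u (\<lambda>y. L y i) x)) (at x)"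
      by (intro has_derivative_sum has_derivative_scaleR_right LD)
    then have "((\<lambda>y. L y (W x)) has_derivative
        (\<lambda>u. \<Sum>i\<in>Basis. (W x \<bullet> i) *\<^sub>R dd u (\<lambda>y. L y i) x)) (at x)"
      by (rule has_derivative_transform_within_open[OF _ S x]) (metis linear_euclidean_expand lin)
    then show ?thesis
      by (simp add: dd_eqI sum.distrib linear_euclidean_expand[OF lin[OF x], of "dd u W x"])
  qed
  ultimately show ?thesis by simp
qed

lemma bilinear_field_has_derivative:
  fixes B :: "'x::real_normed_vector \<Rightarrow> 'a::euclidean_space \<Rightarrow> 'b::euclidean_space \<Rightarrow> 'c::real_normed_vector"
  assumes S: "open S" and x: "x \<in> S" and lin: "\<And>y. y \<in> S \<Longrightarrow> bilinear (B y)"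
    and B: "\<And>a b. (\<lambda>y. B y a b) differentiable (at x)"
    and W: "W differentiable (at x)" and Z: "Z differentiable (at x)"
  shows "((\<lambda>y. B y (W y) (Z y)) has_derivative
    (\<lambda>u. dd u (\<lambda>y. B y (W x) (Z x)) x + B x (dd u W x) (Z x) + B x (W x) (dd u Z x))) (at x)"
proof -
  have 1: "((\<lambda>y. B y (W y) b) has_derivative
    (\<lambda>u. dd u (\<lambda>y. B y (W x) b) x + B x (dd u W x) b)) (at x)" for b
    using linear_field_has_derivative[OF S x, of "\<lambda>y a. B y a b" W] lin B W
    by (simp add: bilinear_linear_left)
  have "((\<lambda>y. B y (W y) (Z y)) has_derivative
    (\<lambda>u. dd u (\<lambda>y. B y (W y) (Z x)) x + B x (W x) (dd u Z x))) (at x)"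
    using lin 1 Z
    by (intro linear_field_has_derivative[OF S x]) (auto intro: differentiableI bilinear_linear_right)
  then show ?thesis by (simp add: dd_eqI[OF 1])
qed

lemma linear_field_smooth:
  fixes L :: "'x::real_normed_vector \<Rightarrow> 'a::euclidean_space \<Rightarrow> 'b::real_normed_vector"
  assumes S: "open S" and lin: "\<And>y. y \<in> S \<Longrightarrow> linear (L y)"
    and L: "\<And>a. smooth_on S (\<lambda>y. L y a)" and W: "smooth_on S W"
  shows "smooth_on S (\<lambda>y. L y (W y))"
proof -
  have "smooth_on S (\<lambda>y. \<Sum>i\<in>Basis. (W y \<bullet> i) *\<^sub>R L y i)"
    by (intro smooth_on_sum smooth_on_scaleR smooth_on_inner_left S W L)
  then show ?thesis
    by (rule smooth_on_cong[THEN iffD2, OF S, rotated]) (rule linear_euclidean_expand[OF lin])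
qed

lemma bilinear_field_smooth:
  fixes B :: "'x::real_normed_vector \<Rightarrow> 'a::euclidean_space \<Rightarrow> 'b::euclidean_space \<Rightarrow> 'c::real_normed_vector"
  assumes S: "open S" and lin: "\<And>y. y \<in> S \<Longrightarrow> bilinear (B y)"
    and B: "\<And>a b. smooth_on S (\<lambda>y. B y a b)" and W: "smooth_on S W" and Z: "smooth_on S Z"
  shows "smooth_on S (\<lambda>y. B y (W y) (Z y))"
proof -
  have 1: "smooth_on S (\<lambda>y. B y (W y) b)" for b
    using linear_field_smooth[OF S, of "\<lambda>y a. B y a b" W] lin bilinear_linear_left B W by blast
  show ?thesis
    using linear_field_smooth[OF S, of "\<lambda>y b. B y (W y) b" Z] lin bilinear_linear_right 1 Z by blast
qed

section \<open>Inner products and orthonormal bases\<close>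

locale inner_form =
  fixes G :: "'e::euclidean_space \<Rightarrow> 'e \<Rightarrow> real"
  assumes bilinear: "bilinear G" and sym: "G u v = G v u" and pos: "u \<noteq> 0 \<Longrightarrow> G u u > 0"
begin

lemmas add_left = bilinear_ladd[OF bilinear] and add_right = bilinear_radd[OF bilinear]
  and scale_left = bilinear_lmul[OF bilinear] and scale_right = bilinear_rmul[OF bilinear]
  and diff_left = bilinear_lsub[OF bilinear] and diff_right = bilinear_rsub[OF bilinear]
  and minus_left = bilinear_lneg[OF bilinear] and minus_right = bilinear_rneg[OF bilinear]
  and zero_left = bilinear_lzero[OF bilinear] and zero_right = bilinear_rzero[OF bilinear]
  and sum_left = bilinear_sum_left[OF bilinear] and sum_right = bilinear_sum_right[OF bilinear]

lemmas form_simps = add_left add_right scale_left scale_right diff_left diff_right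
  minus_left minus_right zero_left zero_right

lemma nonneg: "G u u \<ge> 0"
  by (cases "u = 0") (auto simp: zero_left dest: pos)

lemma nondegenerate: "(\<And>w. G u w = G v w) \<Longrightarrow> u = v"
  using pos[of "u - v"] by (force simp: diff_left)

text \<open>Spanning follows without an independence argument: \<psi> sends the standard basis to e,
  \<phi> reads off G-coordinates, orthonormality gives \<phi> \<circ> \<psi> = id, and in finite
  dimension a one-sided inverse is two-sided.\<close>

lemma basis_expand:
  assumes "orthonormal_basis G e"
  shows "x = (\<Sum>i<DIM('e). G x (e i) *\<^sub>R e i)"
proof -
  obtain b where b: "bij_betw b {..<DIM('e)} (Basis :: 'e set)"
    using ex_bij_betw_nat_finite[of "Basis :: 'e set"] by (auto simp: atLeast0LessThan)
  define \<phi> where "\<phi> x = (\<Sum>i<DIM('e). G x (e i) *\<^sub>R b i)" for x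
  define \<psi> where "\<psi> x = (\<Sum>i<DIM('e). (x \<bullet> b i) *\<^sub>R e i)" for x
  have e: "G (e i) (e j) = (if i = j then 1 else 0)" if "i < DIM('e)" "j < DIM('e)" for i j
    using assms that by (simp add: orthonormal_basis_def)
  have bb: "b i \<bullet> b j = (if i = j then 1 else 0)" if "i < DIM('e)" "j < DIM('e)" for i j
  proof -
    have "b i \<in> Basis" "b j \<in> Basis" "b i = b j \<longleftrightarrow> i = j"
      using that b by (auto simp: bij_betw_def inj_on_eq_iff)
    then show ?thesis by (simp add: inner_Basis)
  qed
  have lin: "linear \<phi>" "linear \<psi>"
    by (auto intro!: linearI simp: \<phi>_def \<psi>_def form_simps inner_add_left algebra_simps
      sum.distrib scaleR_sum_right)
  have "G (\<psi> x) (e j) = x \<bullet> b j" if "j < DIM('e)" for x j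
    using that by (simp add: \<psi>_def sum_left scale_left e if_distrib[of "(*) _"] sum.delta cong: if_cong)
  then have "\<phi> (\<psi> x) = (\<Sum>i<DIM('e). (x \<bullet> b i) *\<^sub>R b i)" for x
    by (simp add: \<phi>_def)
  also have "(\<Sum>i<DIM('e). (x \<bullet> b i) *\<^sub>R b i) = x" for x
    using sum.reindex_bij_betw[OF b, of "\<lambda>i. (x \<bullet> i) *\<^sub>R i"] by (simp add: euclidean_representation)
  finally have "\<phi> \<circ> \<psi> = id" by auto
  then have "\<psi> \<circ> \<phi> = id" using linear_inverse_left lin by blast
  then have "x = \<psi> (\<phi> x)" by (metis comp_apply id_apply)
  moreover have "\<phi> x \<bullet> b i = G x (e i)" if "i < DIM('e)" for i
    using that by (simp add: \<phi>_def inner_sum_left bb if_distrib[of "(*) _"] sum.delta cong: if_cong)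
  ultimately show ?thesis by (simp add: \<psi>_def)
qed

text \<open>This invariance makes the definite descriptions of the mean curvature vector, of |h|^2
  and of the Laplacian well defined. Each basis is expanded in the other, and the coefficients are
  moved from one argument of A to the other.\<close>

lemma trace_eq:
  assumes e: "orthonormal_basis G e" and e': "orthonormal_basis G e'" and A: "bilinear A"
  shows "(\<Sum>i<DIM('e). A (e i) (e i)) = (\<Sum>i<DIM('e). A (e' i) (e' i))"
proof -
  let ?n = "DIM('e)"
  have "(\<Sum>i<?n. A (e i) (e i)) = (\<Sum>i<?n. A (\<Sum>j<?n. G (e i) (e' j) *\<^sub>R e' j) (e i))"
    using basis_expand[OF e'] by simp
  also have "\<dots> = (\<Sum>i<?n. \<Sum>j<?n. A (e' j) (G (e' j) (e i) *\<^sub>R e i))"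
    by (simp add: bilinear_sum_left[OF A] bilinear_lmul[OF A] bilinear_rmul[OF A] sym)
  also have "\<dots> = (\<Sum>j<?n. A (e' j) (\<Sum>i<?n. G (e' j) (e i) *\<^sub>R e i))"
    by (subst sum.swap) (simp add: bilinear_sum_right[OF A])
  also have "\<dots> = (\<Sum>j<?n. A (e' j) (e' j))"
    using basis_expand[OF e] by simp
  finally show ?thesis .
qed

lemma cauchy_schwarz: "(G u v)\<^sup>2 \<le> G u u * G v v"
proof (cases "v = 0")
  case False
  \<comment> \<open>The vector is G v v times the component of u orthogonal to v; the factor avoids
    a division.\<close>
  have "0 \<le> G (G v v *\<^sub>R u - G u v *\<^sub>R v) (G v v *\<^sub>R u - G u v *\<^sub>R v)" by (rule nonneg)
  also have "\<dots> = G v v * (G u u * G v v - (G u v)\<^sup>2)"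
    by (simp add: form_simps sym[of v u] algebra_simps power2_eq_square)
  finally show ?thesis using pos[OF False] by (simp add: zero_le_mult_iff)
qed (simp add: zero_right)

text \<open>Twice the difference of the two sides is the sum of |b k - b l|^2 over all
  pairs.\<close>

lemma sum_cauchy_schwarz:
  assumes "finite K"
  shows "G (\<Sum>k\<in>K. b k) (\<Sum>k\<in>K. b k) \<le> real (card K) * (\<Sum>k\<in>K. G (b k) (b k))"
proof -
  have "0 \<le> (\<Sum>k\<in>K. \<Sum>l\<in>K. G (b k - b l) (b k - b l))"
    by (intro sum_nonneg nonneg)
  also have "\<dots> = (\<Sum>k\<in>K. \<Sum>l\<in>K. G (b k) (b k) + G (b l) (b l) - 2 * G (b k) (b l))"
    by (intro sum.cong refl) (simp add: form_simps sym[of "b _" "b _"] algebra_simps)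
  also have "\<dots> = 2 * (real (card K) * (\<Sum>k\<in>K. G (b k) (b k))) -
      2 * G (\<Sum>k\<in>K. b k) (\<Sum>k\<in>K. b k)"
    by (simp add: sum.distrib sum_subtractf sum_left sum_right sum_distrib_left[symmetric] mult.commute)
      (subst sum.swap, simp)
  finally show ?thesis by simp
qed

end

definition metric_on :: "'e::euclidean_space set \<Rightarrow> ('e \<Rightarrow> 'a::euclidean_space \<Rightarrow> 'a \<Rightarrow> real) \<Rightarrow> bool" where
  "metric_on S G \<longleftrightarrow> (\<forall>x\<in>S. inner_form (G x)) \<and> (\<forall>u v. smooth_on S (\<lambda>x. G x u v))"

text \<open>Gram--Schmidt applied to the standard basis; all operations depend smoothly on the point.\<close>

lemma smooth_orthonormal_frame:
  fixes G :: "'e::euclidean_space \<Rightarrow> 'a::euclidean_space \<Rightarrow> 'a \<Rightarrow> real"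
  assumes S: "open S" and G: "metric_on S G"
  obtains v where "\<And>i. i < DIM('a) \<Longrightarrow> smooth_on S (v i)"
    "\<And>x. x \<in> S \<Longrightarrow> orthonormal_basis (G x) (\<lambda>i. v i x)"
proof -
  obtain b where b: "bij_betw b {..<DIM('a)} (Basis :: 'a set)"
    using ex_bij_betw_nat_finite[of "Basis :: 'a set"] by (auto simp: atLeast0LessThan)
  have form: "inner_form (G x)" if "x \<in> S" for x using G that by (simp add: metric_on_def)
  have smooth_G: "smooth_on S (\<lambda>x. G x (U x) (V x))" if "smooth_on S U" "smooth_on S V" for U V
    using bilinear_field_smooth[OF S inner_form.bilinear[OF form] _ that] G
    by (simp add: metric_on_def)
  \<comment> \<open>The span clause is there for the next step of the induction: b k lies outside
    the span of the vectors built so far, hence the remainder W below vanishes nowhere on S.\<close>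
  have frames: "\<exists>v. (\<forall>i<k. smooth_on S (v i)) \<and> (\<forall>x\<in>S. \<forall>i<k. v i x \<in> span (b ` {..<k})) \<and>
      (\<forall>x\<in>S. \<forall>i<k. \<forall>j<k. G x (v i x) (v j x) = (if i = j then 1 else 0))"
    if "k \<le> DIM('a)" for k
    using that
  proof (induction k)
    case 0
    then show ?case by simp
  next
    case (Suc k)
    then obtain v where vk: "\<forall>i<k. smooth_on S (v i)" "\<forall>x\<in>S. \<forall>i<k. v i x \<in> span (b ` {..<k})"
        "\<forall>x\<in>S. \<forall>i<k. \<forall>j<k. G x (v i x) (v j x) = (if i = j then 1 else 0)"
      using Suc_leD by blast
    then have v: "\<And>i. i < k \<Longrightarrow> smooth_on S (v i)"
      and span: "\<And>x i. x \<in> S \<Longrightarrow> i < k \<Longrightarrow> v i x \<in> span (b ` {..<k})"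
      and orth: "\<And>x i j. \<lbrakk>x \<in> S; i < k; j < k\<rbrakk> \<Longrightarrow> G x (v i x) (v j x) = (if i = j then 1 else 0)"
      by simp_all
    define W where "W x = b k - (\<Sum>i<k. G x (b k) (v i x) *\<^sub>R v i x)" for x
    have W: "smooth_on S W"
      unfolding W_def by (intro smooth_on_diff smooth_on_const smooth_on_sum smooth_on_scaleR smooth_G S)
        (auto intro: v)
    have bk: "b k \<notin> span (b ` {..<k})"
    proof
      assume "b k \<in> span (b ` {..<k})"
      moreover have "b ` {..<k} \<subseteq> Basis - {b k}"
        using b Suc.prems by (force simp: bij_betw_def inj_on_eq_iff)
      ultimately have "b k \<in> span (Basis - {b k})" using span_mono by blast
      moreover have "b k \<in> Basis" using b Suc.prems by (auto simp: bij_betw_def)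
      ultimately show False using independent_Basis unfolding dependent_def by blast
    qed
    have W0: "W x \<noteq> 0" if "x \<in> S" for x
    proof
      assume "W x = 0"
      then have "b k = (\<Sum>i<k. G x (b k) (v i x) *\<^sub>R v i x)" by (simp add: W_def)
      also have "\<dots> \<in> span (b ` {..<k})"
        using span[OF that] by (intro span_sum span_scale) auto
      finally show False using bk by simp
    qed
    have Wpos: "G x (W x) (W x) > 0" if "x \<in> S" for x
      using inner_form.pos[OF form[OF that] W0[OF that]] .
    have Worth: "G x (W x) (v j x) = 0" if "x \<in> S" "j < k" for x j
    proof -
      interpret inner_form "G x" using form that by blast
      show ?thesis
        using that by (simp add: W_def diff_left sum_left scale_left orth if_distrib[of "(*) _"] sum.delta
            cong: if_cong)
    qed
    \<comment> \<open>Division by the length, written with \<open>powr\<close> so that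
      \<open>smooth_on_powr\<close> applies.\<close>
    define e where "e x = (G x (W x) (W x)) powr (-1/2) *\<^sub>R W x" for x
    have e: "smooth_on S e"
      unfolding e_def by (intro smooth_on_scaleR smooth_on_powr smooth_G W S Wpos)
    have ee: "G x (e x) (e x) = 1" if "x \<in> S" for x
    proof -
      interpret inner_form "G x" using form that by blast
      have "G x (e x) (e x) = G x (W x) (W x) powr (-1/2) * G x (W x) (W x) powr (-1/2) * G x (W x) (W x) powr 1"
        using Wpos[OF that] by (simp add: e_def form_simps)
      also have "\<dots> = 1" using Wpos[OF that] by (simp add: powr_add[symmetric])
      finally show ?thesis .
    qed
    have ev: "G x (e x) (v j x) = 0" "G x (v j x) (e x) = 0" if "x \<in> S" "j < k" for x j
    proof -
      interpret inner_form "G x" using form that by blast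
      show "G x (e x) (v j x) = 0" using Worth that by (simp add: e_def scale_left)
      then show "G x (v j x) (e x) = 0" by (simp add: sym)
    qed
    have sub: "span (b ` {..<k}) \<subseteq> span (b ` {..<Suc k})" by (intro span_mono) auto
    have span_e: "e x \<in> span (b ` {..<Suc k})" if "x \<in> S" for x
    proof -
      have "b k \<in> span (b ` {..<Suc k})" by (intro span_base) auto
      moreover have "v i x \<in> span (b ` {..<Suc k})" if "i < k" for i
        using span[OF \<open>x \<in> S\<close> that] sub by blast
      ultimately show ?thesis
        unfolding e_def W_def by (intro span_scale span_diff span_sum) auto
    qed
    define v' where "v' = v(k := e)"
    have "smooth_on S (v' i)" if "i < Suc k" for i
      using that v e by (cases "i = k") (auto simp: v'_def)
    moreover have "v' i x \<in> span (b ` {..<Suc k})" if "x \<in> S" "i < Suc k" for x i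
    proof (cases "i = k")
      case False
      then have "v i x \<in> span (b ` {..<k})" using that span by simp
      then show ?thesis using sub False by (auto simp: v'_def)
    qed (simp add: v'_def span_e that)
    moreover have "G x (v' i x) (v' j x) = (if i = j then 1 else 0)"
      if "x \<in> S" "i < Suc k" "j < Suc k" for x i j
      using that orth[of x i j] ee[of x] ev[of x]
      by (cases "i = k"; cases "j = k") (auto simp: v'_def)
    ultimately show ?case by blast
  qed
  obtain v where "\<forall>i<DIM('a). smooth_on S (v i)"
    "\<forall>x\<in>S. \<forall>i<DIM('a). \<forall>j<DIM('a). G x (v i x) (v j x) = (if i = j then 1 else 0)"
    using frames[OF order_refl] by blast
  then show thesis by (intro that[of v]) (auto simp: orthonormal_basis_def)
qed

text \<open>A single inner product is a constant metric, so a frame for that metric, read at one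
  point, will do.\<close>

lemma (in inner_form) orthonormal_basis_exists: obtains e where "orthonormal_basis G e"
proof -
  have "metric_on (UNIV :: 'e set) (\<lambda>_. G)"
    using inner_form_axioms by (simp add: metric_on_def smooth_on_const)
  then show thesis
  proof (rule smooth_orthonormal_frame[OF open_UNIV])
    fix v assume "\<And>x. x \<in> UNIV \<Longrightarrow> orthonormal_basis G (\<lambda>i. v i (x :: 'e))"
    then show thesis by (rule that[OF _]) simp
  qed
qed

section \<open>The Levi-Civita connection in coordinates\<close>

definition is_levi_civita where
  "is_levi_civita G x \<Gamma> \<longleftrightarrow> bilinear \<Gamma> \<and> (\<forall>u v. \<Gamma> u v = \<Gamma> v u) \<and>
     (\<forall>u v w. dd u (\<lambda>y. G y v w) x = G x (\<Gamma> u v) w + G x v (\<Gamma> u w))"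

text \<open>The Koszul formula for fields with constant components, whose brackets vanish: the
  Christoffel symbols of the first kind.\<close>

definition koszul where
  "koszul G x u v w = (dd u (\<lambda>y. G y v w) x + dd v (\<lambda>y. G y u w) x - dd w (\<lambda>y. G y u v) x) / 2"

definition christoffel where
  "christoffel G x = (THE \<Gamma>. is_levi_civita G x \<Gamma>)"

context
  fixes S :: "'e::euclidean_space set" and G :: "'e \<Rightarrow> 'e \<Rightarrow> 'e \<Rightarrow> real"
  assumes S: "open S" and G: "metric_on S G"
begin

lemma metric_on_form: "x \<in> S \<Longrightarrow> inner_form (G x)"
  using G by (simp add: metric_on_def)

lemma metric_on_smooth: "smooth_on S (\<lambda>x. G x u v)"
  using G by (simp add: metric_on_def)

lemma dd_metric_linear:
  assumes "x \<in> S"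
  shows "linear (\<lambda>u. dd u (\<lambda>y. G y v w) x)" "linear (\<lambda>v. dd u (\<lambda>y. G y v w) x)"
    "linear (\<lambda>w. dd u (\<lambda>y. G y v w) x)"
proof -
  note d = smooth_on_differentiable[OF metric_on_smooth assms]
  note lin = inner_form.bilinear[OF metric_on_form]
  show "linear (\<lambda>u. dd u (\<lambda>y. G y v w) x)"
    using d by (rule dd_linear)
  show "linear (\<lambda>v. dd u (\<lambda>y. G y v w) x)" "linear (\<lambda>w. dd u (\<lambda>y. G y v w) x)"
    by (rule dd_linear_field[OF S assms _ d]; use bilinear_linear_left[OF lin] bilinear_linear_right[OF lin] in simp)+
qed

lemma dd_metric_sym: "x \<in> S \<Longrightarrow> dd u (\<lambda>y. G y v w) x = dd u (\<lambda>y. G y w v) x"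
  by (rule dd_cong_open[OF S]) (simp_all add: inner_form.sym[OF metric_on_form])

lemma koszul_linear:
  assumes "x \<in> S"
  shows "linear (\<lambda>u. koszul G x u v w)" "linear (\<lambda>v. koszul G x u v w)" "linear (koszul G x u v)"
  using dd_metric_linear[OF assms, THEN linear_add] dd_metric_linear[OF assms, THEN linear_cmul]
  by (auto intro!: linearI simp: koszul_def field_simps)

lemma levi_civita_koszul:
  assumes "x \<in> S" "is_levi_civita G x \<Gamma>"
  shows "G x (\<Gamma> u v) w = koszul G x u v w"
proof -
  note [simp] = inner_form.sym[OF metric_on_form[OF assms(1)]]
  have sym: "\<Gamma> u v = \<Gamma> v u" for u v using assms(2) by (simp add: is_levi_civita_def)
  have D: "dd u (\<lambda>y. G y v w) x = G x (\<Gamma> u v) w + G x v (\<Gamma> u w)" for u v w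
    using assms(2) by (simp only: is_levi_civita_def)
  have "G x (\<Gamma> v w) u = G x u (\<Gamma> v w)" "G x v (\<Gamma> u w) = G x (\<Gamma> u w) v" for u v w
    using inner_form.sym[OF metric_on_form[OF assms(1)]] by blast+
  then show ?thesis unfolding koszul_def D
    using sym[of u v] sym[of u w] sym[of v w] by (simp only:) argo
qed

lemma levi_civita_unique:
  assumes "x \<in> S" "is_levi_civita G x \<Gamma>" "is_levi_civita G x \<Gamma>'"
  shows "\<Gamma> = \<Gamma>'"
  by (intro ext inner_form.nondegenerate[OF metric_on_form[OF assms(1)]])
    (simp only: levi_civita_koszul[OF assms(1,2)] levi_civita_koszul[OF assms(1,3)])

text \<open>An orthonormal basis raises the index of the Koszul expression. This yields existence,
  and also the explicit formula from which smooth dependence on the point is read off.\<close>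

lemma christoffel_frame:
  assumes x: "x \<in> S" and e: "orthonormal_basis (G x) e"
  shows "is_levi_civita G x (\<lambda>u v. \<Sum>i<DIM('e). koszul G x u v (e i) *\<^sub>R e i)"
    (is "is_levi_civita G x ?\<Gamma>")
proof -
  interpret inner_form "G x" using metric_on_form[OF x] .
  have k: "G x (?\<Gamma> u v) w = koszul G x u v w" for u v w
  proof -
    have "koszul G x u v w = koszul G x u v (\<Sum>i<DIM('e). G x w (e i) *\<^sub>R e i)"
      using basis_expand[OF e] by simp
    also have "\<dots> = G x (?\<Gamma> u v) w"
      by (simp add: linear_sum[OF koszul_linear(3)[OF x]] linear_cmul[OF koszul_linear(3)[OF x]]
          sum_left scale_left sym[of w] mult.commute)
    finally show ?thesis by simp
  qed
  have "bilinear ?\<Gamma>"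
    using koszul_linear[OF x, THEN linear_add] koszul_linear[OF x, THEN linear_cmul]
    by (intro bilinearI_linear) (auto intro!: linearI simp: scaleR_add_left sum.distrib scaleR_sum_right)
  moreover have "koszul G x u v w = koszul G x v u w" for u v w
    using dd_metric_sym[OF x] by (simp add: koszul_def add.commute)
  moreover have "dd u (\<lambda>y. G y v w) x = G x (?\<Gamma> u v) w + G x v (?\<Gamma> u w)" for u v w
  proof -
    have "G x (?\<Gamma> u v) w + G x v (?\<Gamma> u w) = koszul G x u v w + koszul G x u w v"
      by (simp only: sym[of v "?\<Gamma> u w"] k)
    then show ?thesis
      unfolding koszul_def using dd_metric_sym[OF x, where u = u and v = v and w = w] by argo
  qed
  ultimately show ?thesis unfolding is_levi_civita_def by simp
qed

lemma christoffel:
  assumes "x \<in> S" shows "is_levi_civita G x (christoffel G x)"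
proof -
  obtain e where "orthonormal_basis (G x) e"
    using inner_form.orthonormal_basis_exists[OF metric_on_form[OF assms]] .
  note \<Gamma> = christoffel_frame[OF assms this]
  show ?thesis
    unfolding christoffel_def by (rule theI[where P = "is_levi_civita G x", OF \<Gamma>]) (rule levi_civita_unique[OF assms _ \<Gamma>])
qed

end

lemma christoffel_bilinear:
  "\<lbrakk>open S; metric_on S G; x \<in> S\<rbrakk> \<Longrightarrow> bilinear (christoffel G x)"
  using christoffel unfolding is_levi_civita_def by blast

lemma christoffel_sym:
  "\<lbrakk>open S; metric_on S G; x \<in> S\<rbrakk> \<Longrightarrow> christoffel G x u v = christoffel G x v u"
  using christoffel unfolding is_levi_civita_def by blast

lemma christoffel_metric:
  assumes "open S" "metric_on S G" "x \<in> S"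
  shows "dd u (\<lambda>y. G y v w) x = G x (christoffel G x u v) w + G x v (christoffel G x u w)"
  by (rule christoffel[OF assms, unfolded is_levi_civita_def, THEN conjunct2, THEN conjunct2,
      THEN spec, THEN spec, THEN spec])

text \<open>The definite description says nothing about dependence on x; by uniqueness it agrees at
  each point with the formula for a smooth orthonormal frame.\<close>

lemma christoffel_smooth:
  fixes G :: "'e::euclidean_space \<Rightarrow> 'e \<Rightarrow> 'e \<Rightarrow> real"
  assumes S: "open S" and G: "metric_on S G"
  shows "smooth_on S (\<lambda>x. christoffel G x u v)"
proof (rule smooth_orthonormal_frame[OF S G])
  fix e assume e: "\<And>i. i < DIM('e) \<Longrightarrow> smooth_on S (e i)"
    and on: "\<And>x. x \<in> S \<Longrightarrow> orthonormal_basis (G x) (\<lambda>i. e i x)"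
  have G': "smooth_on S (\<lambda>x. G x u v)" for u v using G by (simp add: metric_on_def)
  have "smooth_on S (\<lambda>x. (1/2) *\<^sub>R (dd u (\<lambda>y. G y v w) x + dd v (\<lambda>y. G y u w) x - dd w (\<lambda>y. G y u v) x))" for w
    by (intro smooth_on_scaleR smooth_on_diff smooth_on_add smooth_on_dd smooth_on_const G' S)
  then have "smooth_on S (\<lambda>x. koszul G x u v w)" for w
    by (simp add: koszul_def)
  then have "smooth_on S (\<lambda>x. koszul G x u v (e i x))" if "i < DIM('e)" for i
    using linear_field_smooth[OF S, of "\<lambda>x. koszul G x u v" "e i"] koszul_linear(3)[OF S G] e[OF that] by blast
  then have "smooth_on S (\<lambda>x. \<Sum>i<DIM('e). koszul G x u v (e i x) *\<^sub>R e i x)"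
    by (intro smooth_on_sum smooth_on_scaleR S) (auto intro: e)
  moreover have "christoffel G x u v = (\<Sum>i<DIM('e). koszul G x u v (e i x) *\<^sub>R e i x)" if "x \<in> S" for x
    using levi_civita_unique[OF S G that christoffel[OF S G that] christoffel_frame[OF S G that on[OF that]]]
    by simp
  ultimately show ?thesis
    by (rule smooth_on_cong[THEN iffD2, OF S, rotated])
qed

section \<open>Covariant derivatives along a map and the Gauss equation\<close>

lemma dd_compose:
  assumes "\<Phi> differentiable (at x)" "g differentiable (at (\<Phi> x))"
  shows "dd u (\<lambda>y. g (\<Phi> y)) x = dd (dd u \<Phi> x) g (\<Phi> x)"
    and "(\<lambda>y. g (\<Phi> y)) differentiable (at x)"
proof -
  have "((\<lambda>y. g (\<Phi> y)) has_derivative (\<lambda>u. dd (dd u \<Phi> x) g (\<Phi> x))) (at x)"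
    using has_derivative_compose[OF assms[unfolded frechet_derivative_works]] .
  then show "dd u (\<lambda>y. g (\<Phi> y)) x = dd (dd u \<Phi> x) g (\<Phi> x)" "(\<lambda>y. g (\<Phi> y)) differentiable (at x)"
    by (auto simp: dd_eqI intro: differentiableI)
qed

text \<open>The covariant derivative of a field W along \<open>\<Phi>\<close>, with values in the
  target of \<open>\<Phi>\<close>, in the direction u of the domain. For W =
  \<open>dd v \<Phi>\<close> it is the ambient term of the Gauss formula.\<close>

definition cov where
  "cov G \<Phi> u W x = dd u W x + christoffel G (\<Phi> x) (dd u \<Phi> x) (W x)"

definition riem where
  "riem G x u v w =
     dd u (\<lambda>y. christoffel G y v w) x + christoffel G x u (christoffel G x v w) -
     (dd v (\<lambda>y. christoffel G y u w) x + christoffel G x v (christoffel G x u w))"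

context
  fixes S :: "'n::euclidean_space set" and G :: "'n \<Rightarrow> 'n \<Rightarrow> 'n \<Rightarrow> real"
    and T :: "'m::euclidean_space set" and \<Phi> :: "'m \<Rightarrow> 'n"
  assumes S: "open S" and G: "metric_on S G" and T: "open T" and \<Phi>: "smooth_on T \<Phi>"
    and \<Phi>_into: "\<And>x. x \<in> T \<Longrightarrow> \<Phi> x \<in> S"
begin

lemma cov_metric:
  assumes x: "x \<in> T" and W: "W differentiable (at x)" and Z: "Z differentiable (at x)"
  shows "dd u (\<lambda>y. G (\<Phi> y) (W y) (Z y)) x =
    G (\<Phi> x) (cov G \<Phi> u W x) (Z x) + G (\<Phi> x) (W x) (cov G \<Phi> u Z x)"
proof -
  interpret inner_form "G (\<Phi> x)" using metric_on_form[OF S G \<Phi>_into[OF x]] .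
  have d: "(\<lambda>z. G z a b) differentiable (at (\<Phi> x))" for a b
    using smooth_on_differentiable[OF metric_on_smooth[OF S G] \<Phi>_into[OF x]] .
  note c = dd_compose[OF smooth_on_differentiable[OF \<Phi> x] d]
  have "dd u (\<lambda>y. G (\<Phi> y) (W y) (Z y)) x = dd u (\<lambda>y. G (\<Phi> y) (W x) (Z x)) x +
      G (\<Phi> x) (dd u W x) (Z x) + G (\<Phi> x) (W x) (dd u Z x)"
    by (rule dd_eqI, rule bilinear_field_has_derivative[OF T x _ c(2) W Z])
      (use \<Phi>_into metric_on_form[OF S G] inner_form.bilinear in blast)
  then show ?thesis
    unfolding c(1) christoffel_metric[OF S G \<Phi>_into[OF x]] cov_def by (simp add: form_simps)
qed

lemma christoffel_along_has_derivative:
  assumes x: "x \<in> T" and W: "W differentiable (at x)" and Z: "Z differentiable (at x)"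
  shows "((\<lambda>y. christoffel G (\<Phi> y) (W y) (Z y)) has_derivative
    (\<lambda>u. dd (dd u \<Phi> x) (\<lambda>z. christoffel G z (W x) (Z x)) (\<Phi> x) +
      christoffel G (\<Phi> x) (dd u W x) (Z x) + christoffel G (\<Phi> x) (W x) (dd u Z x))) (at x)"
proof -
  have d: "(\<lambda>z. christoffel G z a b) differentiable (at (\<Phi> x))" for a b
    using smooth_on_differentiable[OF christoffel_smooth[OF S G] \<Phi>_into[OF x]] .
  note c = dd_compose[OF smooth_on_differentiable[OF \<Phi> x] d]
  show ?thesis
    using bilinear_field_has_derivative[OF T x christoffel_bilinear[OF S G \<Phi>_into] c(2) W Z]
    unfolding c(1) .
qed

lemma cov_differentiable:
  assumes x: "x \<in> T" and W: "smooth_on T W"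
  shows "cov G \<Phi> v W differentiable (at x)"
  unfolding cov_def[abs_def]
  using christoffel_along_has_derivative[OF x smooth_on_differentiable[OF smooth_on_dd[OF \<Phi>] x]
      smooth_on_differentiable[OF W x]]
  by (intro differentiable_add smooth_on_differentiable[OF smooth_on_dd[OF W] x]) (rule differentiableI)

text \<open>Symmetry of the second derivatives of \<open>\<Phi>\<close> joined with torsion-freeness
  in the target.\<close>

lemma cov_sym:
  assumes x: "x \<in> T"
  shows "cov G \<Phi> u (dd v \<Phi>) x = cov G \<Phi> v (dd u \<Phi>) x"
  unfolding cov_def dd_commute[OF T \<Phi> x, of u v]
  using christoffel_sym[OF S G \<Phi>_into[OF x]] by metis

text \<open>The Ricci identity along \<open>\<Phi>\<close>. Constant directions u and v commute, so
  there is no bracket term; the second derivatives of W and of \<open>\<Phi>\<close> cancel, and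
  what remains is the curvature of the target on pushed-forward vectors.\<close>

lemma cov_cov:
  assumes x: "x \<in> T" and W: "smooth_on T W"
  shows "cov G \<Phi> u (cov G \<Phi> v W) x - cov G \<Phi> v (cov G \<Phi> u W) x =
    riem G (\<Phi> x) (dd u \<Phi> x) (dd v \<Phi> x) (W x)"
proof -
  note bil = christoffel_bilinear[OF S G \<Phi>_into[OF x]]
  have 1: "dd u (cov G \<Phi> v W) x = dd u (dd v W) x +
      (dd (dd u \<Phi> x) (\<lambda>z. christoffel G z (dd v \<Phi> x) (W x)) (\<Phi> x) +
        christoffel G (\<Phi> x) (dd u (dd v \<Phi>) x) (W x) + christoffel G (\<Phi> x) (dd v \<Phi> x) (dd u W x))" for u v
  proof (rule dd_eqI)
    show "(cov G \<Phi> v W has_derivative (\<lambda>u. dd u (dd v W) x +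
      (dd (dd u \<Phi> x) (\<lambda>z. christoffel G z (dd v \<Phi> x) (W x)) (\<Phi> x) +
        christoffel G (\<Phi> x) (dd u (dd v \<Phi>) x) (W x) + christoffel G (\<Phi> x) (dd v \<Phi> x) (dd u W x)))) (at x)"
      unfolding cov_def[abs_def]
      by (intro has_derivative_add smooth_on_has_derivative[OF smooth_on_dd[OF W] x]
        christoffel_along_has_derivative x smooth_on_differentiable[OF smooth_on_dd[OF \<Phi>] x]
        smooth_on_differentiable[OF W x])
  qed
  show ?thesis
    unfolding cov_def[of _ _ _ "cov G \<Phi> _ W"] 1 unfolding cov_def riem_def
    by (simp add: bilinear_radd[OF bil] dd_commute[OF T W x, of u v] dd_commute[OF T \<Phi> x, of u v])
qed

text \<open>Metric compatibility and symmetry are all that the derivation of the Koszul formula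
  uses, and both hold along \<open>\<Phi>\<close>. So the tangential part of the ambient derivative
  is the connection of the induced metric, with its index lowered.\<close>

lemma cov_koszul:
  assumes x: "x \<in> T"
  shows "G (\<Phi> x) (cov G \<Phi> u (dd v \<Phi>) x) (dd w \<Phi> x) =
    koszul (\<lambda>x u v. G (\<Phi> x) (dd u \<Phi> x) (dd v \<Phi> x)) x u v w"
proof -
  note sym = inner_form.sym[OF metric_on_form[OF S G \<Phi>_into[OF x]]]
  have D: "dd u (\<lambda>y. G (\<Phi> y) (dd v \<Phi> y) (dd w \<Phi> y)) x =
    G (\<Phi> x) (cov G \<Phi> u (dd v \<Phi>) x) (dd w \<Phi> x) + G (\<Phi> x) (dd v \<Phi> x) (cov G \<Phi> u (dd w \<Phi>) x)" for u v w
    using x by (intro cov_metric smooth_on_differentiable[OF smooth_on_dd[OF \<Phi>]])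
  show ?thesis
    unfolding koszul_def D
    using sym[of "dd v \<Phi> x"] sym[of "dd w \<Phi> x"] sym[of "dd u \<Phi> x"]
      cov_sym[OF x, of u v] cov_sym[OF x, of u w] cov_sym[OF x, of v w] by simp
qed

text \<open>
  A form of the Gauss equation in which the curvature of the induced metric g has already been
  expressed by second derivatives of g, so that its connection need not be differentiated.
\<close>

lemma gauss_mixed:
  defines "g \<equiv> \<lambda>x u v. G (\<Phi> x) (dd u \<Phi> x) (dd v \<Phi> x)"
  assumes x: "x \<in> T" and uw: "\<And>y. y \<in> T \<Longrightarrow> g y u w = 0"
    and uu: "\<And>y. y \<in> T \<Longrightarrow> dd w (\<lambda>y. g y u u) y = 0"
  shows "G (\<Phi> x) (riem G (\<Phi> x) (dd u \<Phi> x) (dd w \<Phi> x) (dd w \<Phi> x)) (dd u \<Phi> x) =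
    - dd u (dd u (\<lambda>y. g y w w)) x / 2
    - G (\<Phi> x) (cov G \<Phi> w (dd w \<Phi>) x) (cov G \<Phi> u (dd u \<Phi>) x)
    + G (\<Phi> x) (cov G \<Phi> u (dd w \<Phi>) x) (cov G \<Phi> u (dd w \<Phi>) x)"
proof -
  interpret inner_form "G (\<Phi> x)" using metric_on_form[OF S G \<Phi>_into[OF x]] .
  have wu: "g y w u = 0" if "y \<in> T" for y
    using uw[OF that] inner_form.sym[OF metric_on_form[OF S G \<Phi>_into[OF that]]] by (simp add: g_def)
  have zero: "dd a (\<lambda>y. g y u w) y = 0" "dd a (\<lambda>y. g y w u) y = 0" if "y \<in> T" for y a
    using dd_cong_open[OF T that, of "\<lambda>y. g y u w" "\<lambda>_. 0"] uw
      dd_cong_open[OF T that, of "\<lambda>y. g y w u" "\<lambda>_. 0"] wu by simp_all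
  \<comment> \<open>All terms with g(u,w) drop out of the Koszul formula. Here the derivative of
    g(w,w) along u survives; in \<open>uw'\<close> only the derivative of g(u,u) along w could, and
    it is zero. Both identities hold throughout T, so they may be differentiated.\<close>
  have ww: "G (\<Phi> y) (cov G \<Phi> w (dd w \<Phi>) y) (dd u \<Phi> y) = - (1/2) *\<^sub>R dd u (\<lambda>y. g y w w) y" if "y \<in> T" for y
    unfolding cov_koszul[OF that] using zero[OF that] by (simp add: koszul_def g_def)
  have uw': "G (\<Phi> y) (cov G \<Phi> u (dd w \<Phi>) y) (dd u \<Phi> y) = 0" if "y \<in> T" for y
    unfolding cov_koszul[OF that] using zero[OF that] uu[OF that] by (simp add: koszul_def g_def)
  note dX = smooth_on_dd[OF \<Phi>]
  note diffX = smooth_on_differentiable[OF dX x]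
  note diffcov = cov_differentiable[OF x dX]
  have "dd u (\<lambda>y. G (\<Phi> y) (cov G \<Phi> w (dd w \<Phi>) y) (dd u \<Phi> y)) x =
      dd u (\<lambda>y. - (1/2) *\<^sub>R dd u (\<lambda>y. g y w w) y) x"
    by (rule dd_cong_open[OF T x ww])
  also have "\<dots> = - (1/2) *\<^sub>R dd u (dd u (\<lambda>y. g y w w)) x"
  proof (rule dd_scaleR_const)
    \<comment> \<open>Differentiability of the first derivative of g(w,w) is obtained by solving
      \<open>ww\<close> for it, whence the factor -2.\<close>
    have "(\<lambda>y. (-2) *\<^sub>R G (\<Phi> y) (cov G \<Phi> w (dd w \<Phi>) y) (dd u \<Phi> y)) differentiable (at x)"
    proof -
      have d: "(\<lambda>z. G z a b) differentiable (at (\<Phi> x))" for a b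
        using smooth_on_differentiable[OF metric_on_smooth[OF S G] \<Phi>_into[OF x]] .
      note c = dd_compose[OF smooth_on_differentiable[OF \<Phi> x] d]
      have "bilinear (G (\<Phi> y))" if "y \<in> T" for y
        using \<Phi>_into[OF that] metric_on_form[OF S G] inner_form.bilinear by blast
      from bilinear_field_has_derivative[OF T x this c(2) diffcov diffX]
      show ?thesis by (intro differentiable_scaleR differentiable_const) (rule differentiableI)
    qed
    then show "dd u (\<lambda>y. g y w w) differentiable (at x)"
      by (rule differentiable_cong_open[OF T x, rotated]) (simp add: ww)
  qed
  finally have 1: "G (\<Phi> x) (cov G \<Phi> u (cov G \<Phi> w (dd w \<Phi>)) x) (dd u \<Phi> x) =
      - dd u (dd u (\<lambda>y. g y w w)) x / 2 - G (\<Phi> x) (cov G \<Phi> w (dd w \<Phi>) x) (cov G \<Phi> u (dd u \<Phi>) x)"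
    unfolding cov_metric[OF x diffcov diffX] by simp
  have "dd w (\<lambda>y. G (\<Phi> y) (cov G \<Phi> u (dd w \<Phi>) y) (dd u \<Phi> y)) x = dd w (\<lambda>_. 0) x"
    by (rule dd_cong_open[OF T x uw'])
  then have 2: "G (\<Phi> x) (cov G \<Phi> w (cov G \<Phi> u (dd w \<Phi>)) x) (dd u \<Phi> x) =
      - G (\<Phi> x) (cov G \<Phi> u (dd w \<Phi>) x) (cov G \<Phi> w (dd u \<Phi>) x)"
    unfolding cov_metric[OF x diffcov diffX] by simp
  show ?thesis
    unfolding cov_cov[OF x dX, symmetric] diff_left 1 2 cov_sym[OF x, of w u] by simp
qed

end

section \<open>Symmetries of the curvature tensor\<close>

text \<open>
  The results on covariant derivatives along \<open>\<Phi>\<close> are used here for the identity map.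
\<close>

lemma riem_antisym: "riem G x u v w = - riem G x v u w"
  by (simp add: riem_def)

lemma smooth_on_ident: "smooth_on T (\<lambda>x. x)"
proof -
  have "Ck_on k T (\<lambda>x. x)" for k
    by (cases k) (auto simp: Ck_on_const)
  then show ?thesis by (simp add: smooth_on_def)
qed

context
  fixes S :: "'n::euclidean_space set" and G :: "'n \<Rightarrow> 'n \<Rightarrow> 'n \<Rightarrow> real"
  assumes S: "open S" and G: "metric_on S G"
begin

lemma riem_linear:
  assumes x: "x \<in> S"
  shows "linear (\<lambda>u. riem G x u v w)" "linear (\<lambda>v. riem G x u v w)" "linear (riem G x u v)"
proof -
  note bil = christoffel_bilinear[OF S G]
  note d = smooth_on_differentiable[OF christoffel_smooth[OF S G] x]
  note l = dd_linear[OF d]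
    dd_linear_field[OF S x bilinear_linear_left[OF bil] d]
    dd_linear_field[OF S x bilinear_linear_right[OF bil] d]
  note simps = l[THEN linear_add] l[THEN linear_cmul] bilinear_ladd[OF bil[OF x]] bilinear_radd[OF bil[OF x]]
    bilinear_lmul[OF bil[OF x]] bilinear_rmul[OF bil[OF x]]
  show "linear (\<lambda>u. riem G x u v w)" "linear (\<lambda>v. riem G x u v w)" "linear (riem G x u v)"
    by (auto intro!: linearI simp: riem_def simps algebra_simps)
qed

text \<open>Symmetry of the Christoffel form makes the six derivative terms and the six quadratic
  terms cancel in pairs.\<close>

lemma riem_bianchi:
  assumes "x \<in> S"
  shows "riem G x u v w + riem G x v w u + riem G x w u v = 0"
proof -
  have "dd a (\<lambda>y. christoffel G y b c) x = dd a (\<lambda>y. christoffel G y c b) x" for a b c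
    by (rule dd_cong_open[OF S assms]) (rule christoffel_sym[OF S G])
  note * = this christoffel_sym[OF S G assms]
  show ?thesis
    unfolding riem_def *(1)[of u v w] *(1)[of v w u] *(1)[of w u v] *(2)[of v w] *(2)[of w u] *(2)[of u v]
    by simp
qed

text \<open>The function G(w,z), with w and z constant, has commuting second derivatives. Expanding
  them by metric compatibility leaves the two curvature terms, as the products of first covariant
  derivatives are symmetric in u and v.\<close>

lemma riem_skew:
  assumes x: "x \<in> S"
  shows "G x (riem G x u v w) z = - G x w (riem G x u v z)"
proof -
  interpret inner_form "G x" using metric_on_form[OF S G x] .
  note metric = cov_metric[OF S G S smooth_on_ident, simplified]
  note cc = cov_cov[OF S G S smooth_on_ident _ _ smooth_on_const, simplified]
  note dcov = cov_differentiable[OF S G S smooth_on_ident _ _ smooth_on_const, simplified]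
  have *: "dd u (dd v (\<lambda>y. G y w z)) x =
      G x (cov G (\<lambda>x. x) u (cov G (\<lambda>x. x) v (\<lambda>_. w)) x) z +
      G x (cov G (\<lambda>x. x) v (\<lambda>_. w) x) (cov G (\<lambda>x. x) u (\<lambda>_. z) x) +
      (G x (cov G (\<lambda>x. x) u (\<lambda>_. w) x) (cov G (\<lambda>x. x) v (\<lambda>_. z) x) +
      G x w (cov G (\<lambda>x. x) u (cov G (\<lambda>x. x) v (\<lambda>_. z)) x))" for u v
  proof -
    have "dd u (dd v (\<lambda>y. G y w z)) x = dd u (\<lambda>y. G y (cov G (\<lambda>x. x) v (\<lambda>_. w) y) z +
        G y w (cov G (\<lambda>x. x) v (\<lambda>_. z) y)) x"
      by (rule dd_cong_open[OF S x]) (simp add: metric)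
    also have "\<dots> = dd u (\<lambda>y. G y (cov G (\<lambda>x. x) v (\<lambda>_. w) y) z) x +
        dd u (\<lambda>y. G y w (cov G (\<lambda>x. x) v (\<lambda>_. z) y)) x"
    proof (rule dd_add)
      have b: "bilinear (G y)" if "y \<in> S" for y
        using metric_on_form[OF S G that] inner_form.bilinear by blast
      have d: "(\<lambda>z. G z a b) differentiable (at x)" for a b
        using smooth_on_differentiable[OF metric_on_smooth[OF S G] x] .
      note * = bilinear_field_has_derivative[OF S x b d]
      show "(\<lambda>y. G y (cov G (\<lambda>x. x) v (\<lambda>_. w) y) z) differentiable (at x)"
        by (rule differentiableI[OF *[OF _ dcov[OF x] differentiable_const]])
      show "(\<lambda>y. G y w (cov G (\<lambda>x. x) v (\<lambda>_. z) y)) differentiable (at x)"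
        by (rule differentiableI[OF *[OF _ differentiable_const dcov[OF x]]])
    qed
    finally show ?thesis using x dcov by (simp add: metric)
  qed
  have "dd u (dd v (\<lambda>y. G y w z)) x = dd v (dd u (\<lambda>y. G y w z)) x"
    using G x by (intro dd_commute[OF S]) (auto simp: metric_on_def)
  then show ?thesis
    unfolding * cc[OF x, symmetric] diff_left diff_right by simp
qed

text \<open>A parallel J commutes with covariant derivatives, hence with their commutator.\<close>

lemma riem_parallel_endo:
  assumes J: "\<And>y. y \<in> S \<Longrightarrow> linear (J y)" "\<And>w. smooth_on S (\<lambda>y. J y w)"
    and par: "\<And>y u w. y \<in> S \<Longrightarrow> dd u (\<lambda>y. J y w) y + christoffel G y u (J y w) = J y (christoffel G y u w)"
    and x: "x \<in> S"
  shows "riem G x u v (J x w) = J x (riem G x u v w)"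
proof -
  note dcov = cov_differentiable[OF S G S smooth_on_ident _ _ smooth_on_const, simplified]
  \<comment> \<open>The hypothesis concerns fields with constant components, but a second covariant
    derivative acts on a varying field; the product rule bridges the two.\<close>
  have covJ: "cov G (\<lambda>x. x) u (\<lambda>y. J y (W y)) y = J y (cov G (\<lambda>x. x) u W y)"
    if y: "y \<in> S" and W: "W differentiable (at y)" for W u y
  proof -
    have "dd u (\<lambda>y. J y (W y)) y = dd u (\<lambda>z. J z (W y)) y + J y (dd u W y)"
      by (rule dd_eqI, rule linear_field_has_derivative[OF S y J(1) _ W])
        (use smooth_on_differentiable[OF J(2) y] in auto)
    then show ?thesis
      using par[OF y, where u = u and w = "W y"] by (simp add: cov_def linear_add[OF J(1)[OF y]] algebra_simps)
  qed
  have covcovJ: "cov G (\<lambda>x. x) u (cov G (\<lambda>x. x) v (\<lambda>y. J y w)) x =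
      J x (cov G (\<lambda>x. x) u (cov G (\<lambda>x. x) v (\<lambda>_. w)) x)" for u v
  proof -
    have "cov G (\<lambda>x. x) u (cov G (\<lambda>x. x) v (\<lambda>y. J y w)) x =
        cov G (\<lambda>x. x) u (\<lambda>y. J y (cov G (\<lambda>x. x) v (\<lambda>_. w) y)) x"
    proof -
      have "dd u (cov G (\<lambda>x. x) v (\<lambda>y. J y w)) x = dd u (\<lambda>y. J y (cov G (\<lambda>x. x) v (\<lambda>_. w) y)) x"
        by (rule dd_cong_open[OF S x]) (simp add: covJ)
      then show ?thesis using x by (simp add: cov_def[of _ _ u] covJ)
    qed
    also have "\<dots> = J x (cov G (\<lambda>x. x) u (cov G (\<lambda>x. x) v (\<lambda>_. w)) x)"
      by (rule covJ[OF x dcov[OF x]])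
    finally show ?thesis .
  qed
  have "riem G x u v (J x w) = cov G (\<lambda>x. x) u (cov G (\<lambda>x. x) v (\<lambda>y. J y w)) x -
      cov G (\<lambda>x. x) v (cov G (\<lambda>x. x) u (\<lambda>y. J y w)) x"
    using cov_cov[OF S G S smooth_on_ident _ x J(2)] by simp
  also have "\<dots> = J x (riem G x u v w)"
    unfolding covcovJ linear_diff[OF J(1)[OF x], symmetric]
    using cov_cov[OF S G S smooth_on_ident _ x smooth_on_const] by simp
  finally show ?thesis .
qed

end

section \<open>Sectional curvature of complex space forms\<close>

text \<open>
  With \<open>a = R(x,y,y,x)\<close> and \<open>b = R(x,Jy,Jy,x)\<close>, polarising \<open>R(x,Jx,Jx,x) = c |x|\<^sup>4\<close> gives
  \<open>a + 3b = c (|x|\<^sup>2 |y|\<^sup>2 + 2 g(x,y)\<^sup>2)\<close>; replacing y by Jy exchanges a and b.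
\<close>

lemma (in inner_form) constant_holomorphic_curvature:
  fixes R :: "'e \<Rightarrow> 'e \<Rightarrow> 'e \<Rightarrow> 'e \<Rightarrow> real"
  assumes J: "linear J" "\<And>u. J (J u) = - u" "\<And>u v. G (J u) (J v) = G u v"
    and R: "\<And>v w z. linear (\<lambda>u. R u v w z)" "\<And>u w z. linear (\<lambda>v. R u v w z)"
      "\<And>u v z. linear (\<lambda>w. R u v w z)" "\<And>u v w. linear (\<lambda>z. R u v w z)"
    and anti12: "\<And>u v w z. R u v w z = - R v u w z"
    and anti34: "\<And>u v w z. R u v w z = - R u v z w"
    and bianchi: "\<And>u v w z. R u v w z + R v w u z + R w u v z = 0"
    and RJ: "\<And>u v w z. R u v (J w) (J z) = R u v w z"
    and hol: "\<And>x. R x (J x) (J x) x = c * (G x x)\<^sup>2"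
  shows "R x y y x = c / 4 * (G x x * G y y - (G x y)\<^sup>2 + 3 * (G x (J y))\<^sup>2)"
proof -
  \<comment> \<open>Pair symmetry is a linear consequence of four instances of the Bianchi identity
    and the two skew symmetries.\<close>
  have pair: "R u v w z = R w z u v" for u v w z
    using bianchi[of u v w z] bianchi[of v w z u] bianchi[of w z u v] bianchi[of z u v w]
      anti12[of u v z w] anti12[of v w u z] anti12[of w u v z] anti12[of u z w v]
      anti12[of v z u w] anti12[of w z u v] anti12[of z v w u] anti12[of z u v w]
      anti34[of u v w z] anti34[of v w u z] anti34[of w u v z] anti34[of u z w v]
      anti34[of v z u w] anti34[of w z u v] anti34[of z v w u] anti34[of z u v w]
      anti34[of v u w z] anti34[of w v u z] anti34[of z w u v] anti34[of u w v z]
    by argo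
  have JR: "R (J u) (J v) w z = R u v w z" for u v w z
    using pair[of "J u" "J v" w z] RJ[of w z u v] pair[of w z u v] by simp
  note lin = R[THEN linear_add] R[THEN linear_cmul] R[THEN linear_neg] R[THEN linear_diff]
    linear_add[OF J(1)] linear_neg[OF J(1)] linear_diff[OF J(1)]
  have polar: "R x y y x + 3 * R x (J y) (J y) x = c * (G x x * G y y + 2 * (G x y)\<^sup>2)" for x y
  proof -
    \<comment> \<open>Adding the values at x + y and x - y keeps only the terms of even degree in y.
      In the notation of the comment above, the mixed ones reduce below to two copies of a + b and
      four of b, doubled: 4 (a + 3b).\<close>
    have "R (x + y) (J (x + y)) (J (x + y)) (x + y) + R (x - y) (J (x - y)) (J (x - y)) (x - y) =
      2 * (R x (J x) (J x) x + R y (J y) (J y) y + R x (J x) (J y) y + R x (J y) (J x) y +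
        R x (J y) (J y) x + R y (J x) (J x) y + R y (J x) (J y) x + R y (J y) (J x) x)"
      by (simp add: lin)
    moreover have "R y (J y) (J x) x = R x (J x) (J y) y"
      using pair[of y "J y" "J x" x] anti12[of "J x" x y "J y"] anti34[of x "J x" y "J y"] by simp
    moreover have "R y (J x) (J y) x = R x (J y) (J x) y"
      using pair[of y "J x" "J y" x] anti12[of "J y" x y "J x"] anti34[of x "J y" y "J x"] by simp
    moreover have "R y (J x) (J x) y = R x (J y) (J y) x"
    proof -
      have "R y (J x) (J x) y = R (J y) (J (J x)) (J (J x)) (J y)"
        using JR RJ by metis
      also have "\<dots> = R (J y) x x (J y)" by (simp add: J(2) lin)
      also have "\<dots> = R x (J y) (J y) x"
        using anti12[of "J y" x x "J y"] anti34[of x "J y" x "J y"] by simp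
      finally show ?thesis .
    qed
    moreover have Jyx: "R x (J y) (J x) y = R x (J y) (J y) x"
    proof -
      have "R x (J y) (J x) y = R x (J y) (J (J x)) (J y)" by (simp add: RJ)
      also have "\<dots> = R x (J y) (J y) x"
        using anti34[of x "J y" x "J y"] by (simp add: J(2) lin)
      finally show ?thesis .
    qed
    \<comment> \<open>The Bianchi identity for x, Jx, Jy, where the pair Jx, Jy in the first two
      places may be replaced by x, y.\<close>
    moreover have "R x (J x) (J y) y = R x y y x + R x (J y) (J y) x"
    proof -
      have "R (J x) (J y) x y = R x y x y" by (rule JR)
      then show ?thesis
        using bianchi[of x "J x" "J y" y] anti34[of x y x y] anti12[of "J y" x "J x" y] Jyx by simp
    qed
    moreover have "R (x + y) (J (x + y)) (J (x + y)) (x + y) + R (x - y) (J (x - y)) (J (x - y)) (x - y) =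
        c * (2 * (G x x)\<^sup>2 + 2 * (G y y)\<^sup>2 + 4 * (G x x * G y y) + 8 * (G x y)\<^sup>2)"
      unfolding hol by (simp add: form_simps sym[of y x] power2_eq_square algebra_simps)
    ultimately have "4 * (R x y y x + 3 * R x (J y) (J y) x) =
        c * (4 * (G x x * G y y) + 8 * (G x y)\<^sup>2)"
      by (simp add: hol algebra_simps)
    then show ?thesis by (simp add: algebra_simps)
  qed
  have "R x (J y) (J y) x + 3 * R x y y x = c * (G x x * G y y + 2 * (G x (J y))\<^sup>2)"
    using polar[of x "J y"] by (simp add: J lin)
  \<comment> \<open>Three times this identity minus the one for y itself is an equation for
    8a.\<close>
  then show ?thesis using polar[of x y] by (simp add: algebra_simps)
qed

section \<open>The inequalities for the second fundamental form\<close>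

text \<open>Merging h(p,p) and h(q,q) into one vector has two effects: the number of vectors falls
  to \<open>card A - 1\<close>, and the sum of their squares acquires the cross term 2 G(h(p,p),
  h(q,q)). The entries (p,q) and (q,p) of |h|^2 account for the remaining term.\<close>

lemma (in inner_form) plane_lower_bound:
  assumes A: "finite A" "p \<in> A" "q \<in> A" "p \<noteq> q" and h: "h q p = h p q"
  shows "G (\<Sum>k\<in>A. h k k) (\<Sum>k\<in>A. h k k) / real (card A - 1) - (\<Sum>k\<in>A. \<Sum>l\<in>A. G (h k l) (h k l)) \<le>
    2 * (G (h p p) (h q q) - G (h p q) (h p q))"
proof -
  define b where "b k = (if k = p then h p p + h q q else h k k)" for k
  have K: "A - {q} = insert p (A - {p, q})" and A': "A = insert p (insert q (A - {p, q}))"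
    using A by auto
  have card: "card (A - {q}) = card A - 1" "card A - 1 > 0"
    using A card_mono[of A "{p, q}"] by auto
  have sb: "(\<Sum>k\<in>A - {q}. b k) = (\<Sum>k\<in>A. h k k)"
  proof -
    have "(\<Sum>k\<in>A - {q}. b k) = h p p + h q q + (\<Sum>k\<in>A - {p, q}. h k k)"
      unfolding K using A by (subst sum.insert) (auto simp: b_def intro!: sum.cong)
    also have "\<dots> = (\<Sum>k\<in>A. h k k)"
      by (subst (2) A') (use A in \<open>simp add: add.assoc\<close>)
    finally show ?thesis .
  qed
  have sbb: "(\<Sum>k\<in>A - {q}. G (b k) (b k)) = (\<Sum>k\<in>A. G (h k k) (h k k)) + 2 * G (h p p) (h q q)"
  proof -
    have "(\<Sum>k\<in>A - {q}. G (b k) (b k)) =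
        G (h p p + h q q) (h p p + h q q) + (\<Sum>k\<in>A - {p, q}. G (h k k) (h k k))"
      unfolding K using A by (subst sum.insert) (auto simp: b_def intro!: sum.cong)
    also have "\<dots> = (\<Sum>k\<in>A. G (h k k) (h k k)) + 2 * G (h p p) (h q q)"
      by (subst (2) A') (use A in \<open>simp add: form_simps sym[of "h q q" "h p p"]\<close>)
    finally show ?thesis .
  qed
  \<comment> \<open>Of |h|^2 only the diagonal and these two off-diagonal entries are kept; the
    positions are disjoint because p \<noteq> q.\<close>
  let ?D = "(\<lambda>k. (k, k)) ` A" and ?E = "{(p, q), (q, p)}"
  have "(\<Sum>k\<in>A. G (h k k) (h k k)) + 2 * G (h p q) (h p q) =
      (\<Sum>(k, l)\<in>?D. G (h k l) (h k l)) + (\<Sum>(k, l)\<in>?E. G (h k l) (h k l))"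
    using A h by (simp add: sum.reindex inj_on_def)
  also have "\<dots> = (\<Sum>(k, l)\<in>?D \<union> ?E. G (h k l) (h k l))"
    using A by (subst sum.union_disjoint) auto
  also have "\<dots> \<le> (\<Sum>(k, l)\<in>A \<times> A. G (h k l) (h k l))"
    using A by (intro sum_mono2) (auto intro: nonneg)
  also have "\<dots> = (\<Sum>k\<in>A. \<Sum>l\<in>A. G (h k l) (h k l))"
    by (simp add: sum.cartesian_product)
  finally have off: "(\<Sum>k\<in>A. G (h k k) (h k k)) + 2 * G (h p q) (h p q) \<le>
      (\<Sum>k\<in>A. \<Sum>l\<in>A. G (h k l) (h k l))" .
  have "G (\<Sum>k\<in>A. h k k) (\<Sum>k\<in>A. h k k) \<le>
      real (card A - 1) * ((\<Sum>k\<in>A. G (h k k) (h k k)) + 2 * G (h p p) (h q q))"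
    using sum_cauchy_schwarz[of "A - {q}" b] A unfolding sb sbb card(1) by simp
  then have "G (\<Sum>k\<in>A. h k k) (\<Sum>k\<in>A. h k k) / real (card A - 1) \<le>
      (\<Sum>k\<in>A. G (h k k) (h k k)) + 2 * G (h p p) (h q q)"
    using card(2) by (simp add: divide_le_eq mult.commute)
  then show ?thesis using off by simp
qed

text \<open>The algebra common to both signs of c. Indices below n1 are horizontal, the others
  vertical, and L stands for the quotient of the Laplacian by f: its formula holds for each vertical
  j with the same L.\<close>

lemma (in inner_form) warped_bounds:
  fixes h :: "nat \<Rightarrow> nat \<Rightarrow> 'e" and K :: "nat \<Rightarrow> nat \<Rightarrow> real"
  assumes n: "n1 > 0" "n2 > 0" and h: "\<And>i j. h i j = h j i"
    and L: "\<And>j. n1 \<le> j \<Longrightarrow> j < n1 + n2 \<Longrightarrow>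
      L = (\<Sum>i<n1. K i j + G (h i i) (h j j) - G (h i j) (h i j))"
    and lo: "\<And>i j. i < n1 \<Longrightarrow> n1 \<le> j \<Longrightarrow> j < n1 + n2 \<Longrightarrow> lo \<le> K i j"
    and hi: "\<And>i j. i < n1 \<Longrightarrow> n1 \<le> j \<Longrightarrow> j < n1 + n2 \<Longrightarrow> K i j \<le> hi"
  defines "m \<equiv> real n1 + real n2"
  defines "H \<equiv> (1 / m) *\<^sub>R (\<Sum>i<n1 + n2. h i i)"
  shows "real n1 * m\<^sup>2 / (2 * (m - 1)) * G H H -
      real n1 / 2 * (\<Sum>i<n1 + n2. \<Sum>j<n1 + n2. G (h i j) (h i j)) + real n1 * lo \<le> L"
    and "L \<le> m\<^sup>2 / (4 * real n2) * G H H + real n1 * hi"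
proof -
  let ?S = "\<Sum>i<n1 + n2. h i i" and ?N = "\<Sum>i<n1 + n2. \<Sum>j<n1 + n2. G (h i j) (h i j)"
  have m: "m > 0" "m - 1 > 0" "real (n1 + n2 - 1) = m - 1" using n by (auto simp: m_def)
  have H: "m\<^sup>2 * G H H = G ?S ?S"
    using m by (simp add: H_def scale_left scale_right power2_eq_square)
  \<comment> \<open>One vertical index suffices; n1 is the first of them.\<close>
  have "real n1 * lo + real n1 * ((G ?S ?S / (m - 1) - ?N) / 2) \<le> L"
  proof -
    have "(\<Sum>i<n1. lo + (G ?S ?S / (m - 1) - ?N) / 2) \<le>
        (\<Sum>i<n1. K i n1 + G (h i i) (h n1 n1) - G (h i n1) (h i n1))"
    proof (rule sum_mono)
      fix i assume i: "i \<in> {..<n1}"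
      then have "G ?S ?S / (m - 1) - ?N \<le> 2 * (G (h i i) (h n1 n1) - G (h i n1) (h i n1))"
        using plane_lower_bound[of "{..<n1 + n2}" i n1 h] h[of n1 i] n unfolding m(3)[symmetric] by simp
      moreover have "lo \<le> K i n1" using lo i n by simp
      ultimately show "lo + (G ?S ?S / (m - 1) - ?N) / 2 \<le> K i n1 + G (h i i) (h n1 n1) - G (h i n1) (h i n1)"
        by argo
    qed
    then show ?thesis using L[of n1] n by (simp add: algebra_simps)
  qed
  then show "real n1 * m\<^sup>2 / (2 * (m - 1)) * G H H - real n1 / 2 * ?N + real n1 * lo \<le> L"
    unfolding H[symmetric] using m by (simp add: field_simps)
  define a where "a = (\<Sum>i<n1. h i i)"
  define b where "b = (\<Sum>j\<in>{n1..<n1 + n2}. h j j)"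
  have S: "?S = a + b"
    unfolding a_def b_def by (subst sum.union_disjoint[symmetric]) (auto intro: sum.cong)
  have "real n2 * L = (\<Sum>j\<in>{n1..<n1 + n2}. L)" by simp
  also have "\<dots> = (\<Sum>j\<in>{n1..<n1 + n2}. \<Sum>i<n1. K i j + G (h i i) (h j j) - G (h i j) (h i j))"
    by (rule sum.cong[OF refl], rule L) auto
  \<comment> \<open>Discarding the squares |h(i,j)|^2 leaves a double sum that factors into the
    product of the two traces.\<close>
  also have "\<dots> \<le> (\<Sum>j\<in>{n1..<n1 + n2}. \<Sum>i<n1. hi + G (h i i) (h j j))"
    using hi nonneg by (intro sum_mono) (smt (verit) atLeastLessThan_iff lessThan_iff)
  also have "\<dots> = real n2 * (real n1 * hi) + G a b"
    by (simp add: sum.distrib a_def b_def sum_left sum_right)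
  also have "G a b \<le> G ?S ?S / 4"
    using nonneg[of "a - b"] unfolding S by (simp add: form_simps sym[of b a])
  finally have "real n2 * L \<le> real n2 * (real n1 * hi) + m\<^sup>2 * G H H / 4"
    unfolding H by simp
  then show "L \<le> m\<^sup>2 / (4 * real n2) * G H H + real n1 * hi"
    using n by (simp add: field_simps)
qed

section \<open>Isometric immersions of warped products in coordinates\<close>

text \<open>The derivative of a linear inner map is constant, so differentiating the composite gives
  a composite of the same kind and the induction closes. It serves to pull functions back along the
  two projections.\<close>

lemma smooth_on_compose_linear:
  assumes L: "bounded_linear L" and A: "open A" "\<And>x. x \<in> A \<Longrightarrow> L x \<in> S" and f: "smooth_on S f"
  shows "smooth_on A (\<lambda>x. f (L x))"
proof -
  have "Ck_on k A (\<lambda>x. f (L x))" if "Ck_on k S f" for k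
    using that
  proof (induction k arbitrary: f)
    case 0
    then show ?case
      using continuous_on_compose2[OF _ linear_continuous_on[OF L], of S f A] A(2) by auto
  next
    case (Suc k)
    have "((\<lambda>x. f (L x)) has_derivative (\<lambda>v. dd (L v) f (L x))) (at x)" if "x \<in> A" for x
      using Suc.prems A(2)[OF that]
      by (intro has_derivative_compose[OF bounded_linear_imp_has_derivative[OF L]])
        (simp add: frechet_derivative_works)
    moreover have "Ck_on k A (\<lambda>x. dd (L v) f (L x))" for v
      using Suc.IH[of "dd (L v) f"] Suc.prems by simp
    ultimately show ?case by (rule Ck_on_SucI[OF A(1)])
  qed
  then show ?thesis using f by (simp add: smooth_on_def)
qed

lemma has_derivative_separated:
  fixes P :: "'a::real_normed_vector \<Rightarrow> real" and Q :: "'b::real_normed_vector \<Rightarrow> real"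
  assumes "P differentiable (at (fst x))" "Q differentiable (at (snd x))"
  shows "((\<lambda>x. P (fst x) * Q (snd x)) has_derivative
    (\<lambda>u. dd (fst u) P (fst x) * Q (snd x) + P (fst x) * dd (snd u) Q (snd x))) (at x)"
proof -
  have "((\<lambda>x. P (fst x)) has_derivative (\<lambda>u. dd (fst u) P (fst x))) (at x)"
    using has_derivative_compose[OF has_derivative_fst[OF has_derivative_ident] assms(1)[unfolded frechet_derivative_works]] .
  moreover have "((\<lambda>x. Q (snd x)) has_derivative (\<lambda>u. dd (snd u) Q (snd x))) (at x)"
    using has_derivative_compose[OF has_derivative_snd[OF has_derivative_ident] assms(2)[unfolded frechet_derivative_works]] .
  ultimately show ?thesis
    by (auto intro!: derivative_eq_intros simp: algebra_simps)
qed

section \<open>The connection of a warped product metric\<close>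

definition warped where
  "warped GB GF F x u v = GB (fst x) (fst u) (fst v) + (F (fst x))\<^sup>2 * GF (snd x) (snd u) (snd v)"

definition sff where
  "sff G W \<Phi> x u v = cov G \<Phi> u (dd v \<Phi>) x - dd (christoffel W x u v) \<Phi> x"

definition hess where
  "hess G F x u v = dd u (dd v F) x - dd (christoffel G x u v) F x"

locale warped_coords =
  fixes SB :: "'e::euclidean_space set" and GB :: "'e \<Rightarrow> 'e \<Rightarrow> 'e \<Rightarrow> real"
    and SF :: "'f::euclidean_space set" and GF :: "'f \<Rightarrow> 'f \<Rightarrow> 'f \<Rightarrow> real"
    and F :: "'e \<Rightarrow> real"
  assumes SB: "open SB" and GB: "metric_on SB GB" and SF: "open SF" and GF: "metric_on SF GF"
    and F: "smooth_on SB F" and F_pos: "y \<in> SB \<Longrightarrow> F y > 0"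
begin

abbreviation "W \<equiv> warped GB GF F"

lemma formB: "y \<in> SB \<Longrightarrow> inner_form (GB y)" and formF: "z \<in> SF \<Longrightarrow> inner_form (GF z)"
  using GB GF by (auto simp: metric_on_def)

lemma warped_form:
  assumes "x \<in> SB \<times> SF" shows "inner_form (W x)"
proof -
  interpret B: inner_form "GB (fst x)" using assms formB by auto
  interpret F: inner_form "GF (snd x)" using assms formF by auto
  have F0: "F (fst x) > 0" using assms F_pos by auto
  show ?thesis
  proof
    show "bilinear (W x)"
      by (intro bilinearI_linear linearI) (simp_all add: warped_def B.form_simps F.form_simps algebra_simps)
    show "W x u v = W x v u" for u v
      unfolding warped_def using B.sym F.sym by metis
    show "W x u u > 0" if "u \<noteq> 0" for u
    proof (cases "fst u = 0")
      case True
      then have "snd u \<noteq> 0" using that by (simp add: prod_eq_iff)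
      then show ?thesis using True F.pos[of "snd u"] F0 by (simp add: warped_def B.zero_left)
    next
      case False
      then show ?thesis using B.pos[of "fst u"] F.nonneg[of "snd u"]
        by (simp add: warped_def add_pos_nonneg)
    qed
  qed
qed

lemma warped_metric: "metric_on (SB \<times> SF) W"
proof -
  have o: "open (SB \<times> SF)" using SB SF by (rule open_Times)
  have "smooth_on (SB \<times> SF) (\<lambda>x. GB (fst x) (fst u) (fst v) +
      (F (fst x) * F (fst x)) * GF (snd x) (snd u) (snd v))" for u v
    using metric_on_smooth[OF SB GB] metric_on_smooth[OF SF GF] F
    by (intro smooth_on_add smooth_on_mult o smooth_on_compose_linear[where S = SB and L = fst]
        smooth_on_compose_linear[where S = SF and L = snd] bounded_linear_fst bounded_linear_snd) auto
  then show ?thesis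
    using warped_form by (simp add: metric_on_def warped_def power2_eq_square)
qed

lemma dd_warped:
  assumes x: "x \<in> SB \<times> SF"
  shows "dd p (\<lambda>x. W x u v) x = dd (fst p) (\<lambda>y. GB y (fst u) (fst v)) (fst x) +
    2 * F (fst x) * dd (fst p) F (fst x) * GF (snd x) (snd u) (snd v) +
    (F (fst x))\<^sup>2 * dd (snd p) (\<lambda>z. GF z (snd u) (snd v)) (snd x)"
proof -
  have x': "fst x \<in> SB" "snd x \<in> SF" using x by auto
  note dB = smooth_on_differentiable[OF metric_on_smooth[OF SB GB] x'(1)]
  note dF = smooth_on_differentiable[OF metric_on_smooth[OF SF GF] x'(2)]
  have "((\<lambda>y. F y * F y) has_derivative (\<lambda>u. 2 * F (fst x) * dd u F (fst x))) (at (fst x))"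
    using smooth_on_has_derivative[OF F x'(1)] by (auto intro!: derivative_eq_intros)
  then have d2: "(\<lambda>y. F y * F y) differentiable (at (fst x))"
    "dd u (\<lambda>y. F y * F y) (fst x) = 2 * F (fst x) * dd u F (fst x)" for u
    by (auto intro: differentiableI dd_eqI)
  \<comment> \<open>The base term is read as a product with the constant 1, so that both summands
    have the separated form.\<close>
  have "((\<lambda>x. W x u v) has_derivative (\<lambda>p. (dd (fst p) (\<lambda>y. GB y (fst u) (fst v)) (fst x) * 1 +
      GB (fst x) (fst u) (fst v) * dd (snd p) (\<lambda>_. 1) (snd x)) +
      (dd (fst p) (\<lambda>y. F y * F y) (fst x) * GF (snd x) (snd u) (snd v) +
      F (fst x) * F (fst x) * dd (snd p) (\<lambda>z. GF z (snd u) (snd v)) (snd x)))) (at x)"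
    using has_derivative_add[OF has_derivative_separated[OF dB differentiable_const[of 1]]
      has_derivative_separated[OF d2(1) dF]]
    by (simp add: warped_def power2_eq_square)
  from dd_eqI[OF this] show ?thesis by (simp add: d2 power2_eq_square)
qed

text \<open>Exactly the components that enter the Gauss equation for a horizontal and a vertical
  direction. Of the vertical-vertical one only the horizontal part matters, as it is paired with the
  horizontal-horizontal one, which is horizontal by the first equation.\<close>

lemma christoffel_warped:
  assumes x: "x \<in> SB \<times> SF"
  shows "christoffel W x (a, 0) (a, 0) = (christoffel GB (fst x) a a, 0)"
    and "christoffel W x (a, 0) (0, t) = (dd a F (fst x) / F (fst x)) *\<^sub>R (0, t)"
    and "W x (christoffel W x (0, t) (0, t)) (b, 0) =
      - F (fst x) * dd b F (fst x) * GF (snd x) t t"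
proof -
  have x': "fst x \<in> SB" "snd x \<in> SF" using x by auto
  interpret B: inner_form "GB (fst x)" using formB x' by blast
  interpret F: inner_form "GF (snd x)" using formF x' by blast
  interpret W: inner_form "W x" by (rule warped_form[OF x])
  have o: "open (SB \<times> SF)" using SB SF by (rule open_Times)
  have k: "W x (christoffel W x u v) w = koszul W x u v w" for u v w
    by (rule levi_civita_koszul[OF o warped_metric x christoffel[OF o warped_metric x]])
  have kB: "GB (fst x) (christoffel GB (fst x) u v) w = koszul GB (fst x) u v w" for u v w
    by (rule levi_civita_koszul[OF SB GB x'(1) christoffel[OF SB GB x'(1)]])
  have F0: "F (fst x) > 0" using x' F_pos by auto
  have zB: "dd p (\<lambda>y. GB y 0 b) (fst x) = 0" "dd p (\<lambda>y. GB y b 0) (fst x) = 0" for p b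
    using linear_0[OF dd_metric_linear(2)[OF SB GB x'(1)]] linear_0[OF dd_metric_linear(3)[OF SB GB x'(1)]] .
  have zF: "dd p (\<lambda>y. GF y 0 b) (snd x) = 0" "dd p (\<lambda>y. GF y b 0) (snd x) = 0" for p b
    using linear_0[OF dd_metric_linear(2)[OF SF GF x'(2)]] linear_0[OF dd_metric_linear(3)[OF SF GF x'(2)]] .
  have zF': "dd 0 (\<lambda>y. GF y b c) (snd x) = 0" for b c
    by (rule linear_0[OF dd_metric_linear(1)[OF SF GF x'(2)]])
  have z0: "dd 0 F (fst x) = 0" "dd 0 (\<lambda>y. GB y b c) (fst x) = 0" for b c
    using linear_0[OF dd_linear[OF smooth_on_differentiable[OF F x'(1)]]]
      linear_0[OF dd_metric_linear(1)[OF SB GB x'(1)]] .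
  note [simp] = zB zF zF' z0 F.zero_left F.zero_right B.zero_left B.zero_right
  show "christoffel W x (a, 0) (a, 0) = (christoffel GB (fst x) a a, 0)"
  proof (rule W.nondegenerate)
    fix w
    show "W x (christoffel W x (a, 0) (a, 0)) w = W x (christoffel GB (fst x) a a, 0) w"
      unfolding k by (simp add: warped_def[of _ _ _ x] kB) (simp add: koszul_def dd_warped[OF x])
  qed
  show "christoffel W x (a, 0) (0, t) = (dd a F (fst x) / F (fst x)) *\<^sub>R (0, t)"
  proof (rule W.nondegenerate)
    fix w
    show "W x (christoffel W x (a, 0) (0, t)) w = W x ((dd a F (fst x) / F (fst x)) *\<^sub>R (0, t)) w"
      unfolding k W.scale_left using F0
      by (simp add: warped_def[of _ _ _ x]) (simp add: koszul_def dd_warped[OF x] power2_eq_square)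
  qed
  show "W x (christoffel W x (0, t) (0, t)) (b, 0) = - F (fst x) * dd b F (fst x) * GF (snd x) t t"
    unfolding k by (simp add: koszul_def dd_warped[OF x])
qed

end

text \<open>T may be smaller than the product of the coordinate domains: it stands for the points
  whose image lies in the domain of the ambient chart.\<close>

locale warped_immersion_coords = warped_coords SB GB SF GF F
  for SB :: "'e::euclidean_space set" and GB and SF :: "'f::euclidean_space set" and GF and F +
  fixes S :: "'n::euclidean_space set" and G :: "'n \<Rightarrow> 'n \<Rightarrow> 'n \<Rightarrow> real"
    and T :: "('e \<times> 'f) set" and \<Phi> :: "'e \<times> 'f \<Rightarrow> 'n"
  assumes S: "open S" and G: "metric_on S G" and T: "open T" "T \<subseteq> SB \<times> SF"
    and \<Phi>: "smooth_on T \<Phi>" and \<Phi>_into: "x \<in> T \<Longrightarrow> \<Phi> x \<in> S"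
    and isometric: "x \<in> T \<Longrightarrow> G (\<Phi> x) (dd u \<Phi> x) (dd v \<Phi> x) = warped GB GF F x u v"
begin

lemma open_product: "open (SB \<times> SF)" using SB SF by (rule open_Times)

lemma dd_isometric: "x \<in> T \<Longrightarrow> dd p (\<lambda>x. G (\<Phi> x) (dd u \<Phi> x) (dd v \<Phi> x)) x = dd p (\<lambda>x. W x u v) x"
  by (rule dd_cong_open[OF T(1)]) (simp_all add: isometric)

text \<open>The tangential part of the ambient derivative and the subtracted intrinsic term obey the
  same Koszul formula, that of W.\<close>

lemma sff_normal:
  assumes x: "x \<in> T"
  shows "G (\<Phi> x) (sff G W \<Phi> x u v) (dd w \<Phi> x) = 0"
proof -
  interpret inner_form "G (\<Phi> x)" using metric_on_form[OF S G \<Phi>_into[OF x]] .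
  have x': "x \<in> SB \<times> SF" using x T by auto
  have "G (\<Phi> x) (cov G \<Phi> u (dd v \<Phi>) x) (dd w \<Phi> x) = koszul W x u v w"
    using cov_koszul[OF S G T(1) \<Phi> \<Phi>_into x] by (simp add: koszul_def dd_isometric x)
  also have "\<dots> = W x (christoffel W x u v) w"
    using levi_civita_koszul[OF open_product warped_metric x' christoffel[OF open_product warped_metric x']]
    by simp
  finally show ?thesis by (simp add: sff_def diff_left isometric x)
qed

lemma sff_bilinear:
  assumes x: "x \<in> T" shows "bilinear (sff G W \<Phi> x)"
proof -
  have x': "x \<in> SB \<times> SF" using x T by auto
  note b = christoffel_bilinear[OF S G \<Phi>_into[OF x]] christoffel_bilinear[OF open_product warped_metric x']
  note d1 = dd_linear[OF smooth_on_differentiable[OF \<Phi> x]]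
  note dd = smooth_on_differentiable[OF smooth_on_dd[OF \<Phi>] x]
  note d2 = dd_linear[OF dd]
    dd_linear_field[OF T(1) x dd_linear[OF smooth_on_differentiable[OF \<Phi>]] dd]
  note simps = b[THEN bilinear_ladd] b[THEN bilinear_radd] b[THEN bilinear_lmul] b[THEN bilinear_rmul]
    linear_add[OF d1] linear_cmul[OF d1] d2[THEN linear_add] d2[THEN linear_cmul]
  show ?thesis
    by (intro bilinearI_linear linearI) (simp_all add: sff_def cov_def simps algebra_simps)
qed

lemma sff_sym:
  assumes x: "x \<in> T" shows "sff G W \<Phi> x u v = sff G W \<Phi> x v u"
proof -
  have x': "x \<in> SB \<times> SF" using x T by auto
  show ?thesis
    using cov_sym[OF S G T(1) \<Phi> \<Phi>_into x, where u = u and v = v]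
      christoffel_sym[OF open_product warped_metric x', of u v] by (simp add: sff_def)
qed

text \<open>\<open>gauss_mixed\<close> for the directions (a,0) and (0,t). Up to the factor GF(t,t),
  with D for the derivative along a, the intrinsic terms are -((DF)^2 + F DDF), then F times the
  derivative of F along the Christoffel vector of a and a, then (DF)^2. The squares cancel and the
  rest is -F times the Hessian.\<close>

lemma warped_gauss:
  assumes x: "x \<in> T"
  shows "G (\<Phi> x) (riem G (\<Phi> x) (dd (a, 0) \<Phi> x) (dd (0, t) \<Phi> x) (dd (0, t) \<Phi> x)) (dd (a, 0) \<Phi> x) =
    - F (fst x) * GF (snd x) t t * hess GB F (fst x) a a
    - G (\<Phi> x) (sff G W \<Phi> x (a, 0) (a, 0)) (sff G W \<Phi> x (0, t) (0, t))
    + G (\<Phi> x) (sff G W \<Phi> x (a, 0) (0, t)) (sff G W \<Phi> x (a, 0) (0, t))"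
proof -
  interpret inner_form "G (\<Phi> x)" using metric_on_form[OF S G \<Phi>_into[OF x]] .
  let ?h = "sff G W \<Phi> x" and ?\<Gamma> = "christoffel W x" and ?u = "(a, 0)" and ?w = "(0, t)"
  have TD: "fst y \<in> SB" "snd y \<in> SF" "y \<in> SB \<times> SF" if "y \<in> T" for y using that T by auto
  have 0: "GB (fst y) 0 b = 0" "GB (fst y) b 0 = 0" "GF (snd y) 0 c = 0" "GF (snd y) c 0 = 0"
    "dd 0 F (fst y) = 0" "dd 0 (\<lambda>z. GB z b d) (fst y) = 0" "dd p (\<lambda>z. GB z 0 0) (fst y) = 0"
    "dd q (\<lambda>z. GF z 0 0) (snd y) = 0" "dd 0 (\<lambda>z. GF z c s) (snd y) = 0" if "y \<in> T" for y b c d p q s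
    using inner_form.zero_left[OF formB] inner_form.zero_right[OF formB] TD[OF that]
      inner_form.zero_left[OF formF] inner_form.zero_right[OF formF]
      linear_0[OF dd_linear[OF smooth_on_differentiable[OF F]]]
      linear_0[OF dd_metric_linear(1)[OF SB GB]] linear_0[OF dd_metric_linear(2)[OF SB GB]]
      linear_0[OF dd_metric_linear(1)[OF SF GF]] linear_0[OF dd_metric_linear(2)[OF SF GF]]
    by simp_all
  have A: "cov G \<Phi> u (dd v \<Phi>) x = ?h u v + dd (?\<Gamma> u v) \<Phi> x" for u v
    by (simp add: sff_def)
  \<comment> \<open>The mixed products of the normal and the tangential part vanish by
    \<open>sff_normal\<close>.\<close>
  have AA: "G (\<Phi> x) (cov G \<Phi> u (dd v \<Phi>) x) (cov G \<Phi> u' (dd v' \<Phi>) x) =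
      G (\<Phi> x) (?h u v) (?h u' v') + W x (?\<Gamma> u v) (?\<Gamma> u' v')" for u v u' v'
    unfolding A using sff_normal[OF x] sym[of "dd (?\<Gamma> u v) \<Phi> x" "?h u' v'"]
    by (simp add: form_simps isometric[OF x])
  have "dd ?u (dd ?u (\<lambda>x. G (\<Phi> x) (dd ?w \<Phi> x) (dd ?w \<Phi> x))) x =
      dd ?u (\<lambda>y. (2 * F (fst y) * dd a F (fst y)) * GF (snd y) t t) x"
    by (rule dd_cong_open[OF T(1) x]) (simp add: dd_isometric dd_warped[OF TD(3)] 0)
  also have "\<dots> = 2 * ((dd a F (fst x))\<^sup>2 + F (fst x) * dd a (dd a F) (fst x)) * GF (snd x) t t"
  proof -
    have "((\<lambda>y. 2 * F y * dd a F y) has_derivative (\<lambda>v. 2 * (dd v F (fst x) * dd a F (fst x) +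
        F (fst x) * dd v (dd a F) (fst x)))) (at (fst x))"
      using smooth_on_has_derivative[OF F TD(1)[OF x]] smooth_on_has_derivative[OF smooth_on_dd[OF F] TD(1)[OF x]]
      by (auto intro!: derivative_eq_intros simp: algebra_simps)
    then have d: "(\<lambda>y. 2 * F y * dd a F y) differentiable (at (fst x))"
      "dd v (\<lambda>y. 2 * F y * dd a F y) (fst x) = 2 * (dd v F (fst x) * dd a F (fst x) +
        F (fst x) * dd v (dd a F) (fst x))" for v
      by (auto intro: differentiableI dd_eqI)
    show ?thesis
      by (subst dd_eqI[OF has_derivative_separated[OF d(1)
            smooth_on_differentiable[OF metric_on_smooth[OF SF GF] TD(2)[OF x]]]])
        (simp add: d(2) 0[OF x] power2_eq_square)
  qed
  finally have D2: "dd ?u (dd ?u (\<lambda>x. G (\<Phi> x) (dd ?w \<Phi> x) (dd ?w \<Phi> x))) x =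
    2 * ((dd a F (fst x))\<^sup>2 + F (fst x) * dd a (dd a F) (fst x)) * GF (snd x) t t" .
  have F0: "F (fst x) > 0" using F_pos TD[OF x] by simp
  have W1: "W x (?\<Gamma> ?w ?w) (?\<Gamma> ?u ?u) = - F (fst x) * dd (christoffel GB (fst x) a a) F (fst x) * GF (snd x) t t"
    unfolding christoffel_warped(1)[OF TD(3)[OF x]] by (rule christoffel_warped(3)[OF TD(3)[OF x]])
  have W2: "W x (?\<Gamma> ?u ?w) (?\<Gamma> ?u ?w) = (dd a F (fst x))\<^sup>2 * GF (snd x) t t"
  proof -
    interpret W: inner_form "W x" using TD[OF x] warped_form by blast
    show ?thesis
      unfolding christoffel_warped(2)[OF TD(3)[OF x]] W.scale_left W.scale_right
      using F0 by (simp add: warped_def 0[OF x] power2_eq_square)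
  qed
  have "G (\<Phi> x) (riem G (\<Phi> x) (dd ?u \<Phi> x) (dd ?w \<Phi> x) (dd ?w \<Phi> x)) (dd ?u \<Phi> x) =
    - dd ?u (dd ?u (\<lambda>x. G (\<Phi> x) (dd ?w \<Phi> x) (dd ?w \<Phi> x))) x / 2
    - G (\<Phi> x) (cov G \<Phi> ?w (dd ?w \<Phi>) x) (cov G \<Phi> ?u (dd ?u \<Phi>) x)
    + G (\<Phi> x) (cov G \<Phi> ?u (dd ?w \<Phi>) x) (cov G \<Phi> ?u (dd ?w \<Phi>) x)"
  proof (rule gauss_mixed[OF S G T(1) \<Phi> \<Phi>_into x])
    show "G (\<Phi> y) (dd ?u \<Phi> y) (dd ?w \<Phi> y) = 0" if "y \<in> T" for y
      by (simp add: isometric[OF that] warped_def 0[OF that])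
    show "dd ?w (\<lambda>y. G (\<Phi> y) (dd ?u \<Phi> y) (dd ?u \<Phi> y)) y = 0" if "y \<in> T" for y
      by (simp add: dd_isometric[OF that] dd_warped[OF TD(3)[OF that]] 0[OF that])
  qed
  then show ?thesis
    unfolding D2 AA W1 W2 hess_def sym[of "?h ?w ?w"] by (simp add: field_simps)
qed

end

section \<open>From charts to coordinates\<close>

context
  fixes \<kappa> :: "('a::topological_space, 'e::euclidean_space) chart"
  assumes \<kappa>: "is_chart \<kappa>"
begin

lemma chart_open: "open (fst \<kappa>)" "open (snd \<kappa> ` fst \<kappa>)"
  and chart_inv_left: "p \<in> fst \<kappa> \<Longrightarrow> chart_inv \<kappa> (snd \<kappa> p) = p"
  and chart_inv_right: "y \<in> snd \<kappa> ` fst \<kappa> \<Longrightarrow> snd \<kappa> (chart_inv \<kappa> y) = y"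
  and chart_inv_into: "y \<in> snd \<kappa> ` fst \<kappa> \<Longrightarrow> chart_inv \<kappa> y \<in> fst \<kappa>"
  using \<kappa> by (auto simp: is_chart_def homeomorphism_def)

lemma chart_open_image:
  assumes "open N" "N \<subseteq> fst \<kappa>" shows "open (snd \<kappa> ` N)"
proof -
  have "homeomorphism (fst \<kappa>) (snd \<kappa> ` fst \<kappa>) (snd \<kappa>) (chart_inv \<kappa>)"
    using \<kappa> by (simp add: is_chart_def)
  then have "openin (top_of_set (snd \<kappa> ` fst \<kappa>)) (snd \<kappa> ` N)"
    using homeomorphism_imp_open_map assms chart_open by (metis openin_open_eq)
  then show ?thesis using chart_open(2) openin_open_trans by blast
qed

lemma dir_deriv_local:
  assumes "p \<in> fst \<kappa>" "\<And>q. q \<in> fst \<kappa> \<Longrightarrow> Y q = Z (snd \<kappa> q)"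
  shows "dir_deriv \<kappa> Y p u = dd u Z (snd \<kappa> p)"
  unfolding dir_deriv_def
  using assms chart_inv_into chart_inv_right by (intro dd_cong_open[OF chart_open(2)]) auto

lemma levi_civita_form_local:
  assumes "p \<in> fst \<kappa>"
  shows "levi_civita_form \<kappa> g p = christoffel (\<lambda>y. g \<kappa> (chart_inv \<kappa> y)) (snd \<kappa> p)"
  unfolding levi_civita_form_def christoffel_def is_levi_civita_def dir_deriv_def comp_def
  by (simp add: chart_inv_left[OF assms])

lemma nabla_const_local:
  assumes "p \<in> fst \<kappa>"
  shows "nabla \<kappa> g p u (\<lambda>_. v) = christoffel (\<lambda>y. g \<kappa> (chart_inv \<kappa> y)) (snd \<kappa> p) u v"
  by (simp add: nabla_def dir_deriv_def comp_def levi_civita_form_local[OF assms])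

lemma curvature_local:
  assumes "p \<in> fst \<kappa>"
  shows "curvature \<kappa> g p u v w = riem (\<lambda>y. g \<kappa> (chart_inv \<kappa> y)) (snd \<kappa> p) u v w"
proof -
  have "nabla \<kappa> g p u (\<lambda>q. nabla \<kappa> g q v (\<lambda>_. w)) =
    dd u (\<lambda>y. christoffel (\<lambda>y. g \<kappa> (chart_inv \<kappa> y)) y v w) (snd \<kappa> p) +
    christoffel (\<lambda>y. g \<kappa> (chart_inv \<kappa> y)) (snd \<kappa> p) u
      (christoffel (\<lambda>y. g \<kappa> (chart_inv \<kappa> y)) (snd \<kappa> p) v w)" for u v
    unfolding nabla_def[of _ _ _ _ "\<lambda>q. nabla \<kappa> g q v (\<lambda>_. w)"]
    by (simp add: levi_civita_form_local[OF assms] nabla_const_local[OF assms]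
        dir_deriv_local[OF assms, of "\<lambda>q. nabla \<kappa> g q v (\<lambda>_. w)"
          "\<lambda>y. christoffel (\<lambda>y. g \<kappa> (chart_inv \<kappa> y)) y v w"] nabla_const_local)
  then show ?thesis by (simp add: curvature_def riem_def)
qed

text \<open>The derivative of the components of a frame field contributes the same term to both
  parts of the defining expression and cancels. What is left is minus the trace of the Hessian,
  which by \<open>trace_eq\<close> may be taken in any orthonormal basis at p.\<close>

lemma laplacian_local:
  assumes G: "metric_on (snd \<kappa> ` fst \<kappa>) (\<lambda>y. g \<kappa> (chart_inv \<kappa> y))"
    and f: "smooth_on (snd \<kappa> ` fst \<kappa>) (f \<circ> chart_inv \<kappa>)"
    and p: "p \<in> fst \<kappa>" and e: "orthonormal_basis (g \<kappa> p) e"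
  shows "laplacian \<kappa> g f p =
    - (\<Sum>i<DIM('e). hess (\<lambda>y. g \<kappa> (chart_inv \<kappa> y)) (f \<circ> chart_inv \<kappa>) (snd \<kappa> p) (e i) (e i))"
proof -
  let ?G = "\<lambda>y. g \<kappa> (chart_inv \<kappa> y)" and ?F = "f \<circ> chart_inv \<kappa>" and ?x = "snd \<kappa> p"
  let ?r = "\<lambda>v. \<Sum>i<DIM('e). dir_deriv \<kappa> f p (nabla \<kappa> g p (v i p) (v i)) -
      dir_deriv \<kappa> (\<lambda>q. dir_deriv \<kappa> f q (v i q)) p (v i p)"
  have x: "?x \<in> snd \<kappa> ` fst \<kappa>" using p by simp
  have form: "inner_form (g \<kappa> p)" using metric_on_form[OF chart_open(2) G x] chart_inv_left[OF p] by simp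
  have bil: "bilinear (hess ?G ?F ?x)"
  proof -
    note b = christoffel_bilinear[OF chart_open(2) G x]
    note d1 = dd_linear[OF smooth_on_differentiable[OF f x]]
    note dd = smooth_on_differentiable[OF smooth_on_dd[OF f] x]
    note d2 = dd_linear[OF dd]
      dd_linear_field[OF chart_open(2) x dd_linear[OF smooth_on_differentiable[OF f]] dd]
    note simps = b[THEN bilinear_ladd] b[THEN bilinear_radd] b[THEN bilinear_lmul] b[THEN bilinear_rmul]
      linear_add[OF d1] linear_cmul[OF d1] d2[THEN linear_add] d2[THEN linear_cmul]
    show ?thesis
      by (intro bilinearI_linear linearI) (simp_all add: hess_def simps algebra_simps)
  qed
  have frame: "?r v = - (\<Sum>i<DIM('e). hess ?G ?F ?x (e i) (e i))"
    if v: "local_orthonormal_frame \<kappa> g p v" for v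
  proof -
    obtain N where N: "open N" "p \<in> N" "N \<subseteq> fst \<kappa>"
      and sm: "\<And>i. i < DIM('e) \<Longrightarrow> smooth_on (snd \<kappa> ` N) (v i \<circ> chart_inv \<kappa>)"
      and on: "orthonormal_basis (g \<kappa> p) (\<lambda>i. v i p)"
      using v unfolding local_orthonormal_frame_def by blast
    note oN = chart_open_image[OF N(1,3)]
    have "dir_deriv \<kappa> f p (nabla \<kappa> g p (v i p) (v i)) -
      dir_deriv \<kappa> (\<lambda>q. dir_deriv \<kappa> f q (v i q)) p (v i p) = - hess ?G ?F ?x (v i p) (v i p)"
      if i: "i < DIM('e)" for i
    proof -
      let ?V = "v i \<circ> chart_inv \<kappa>" and ?u = "v i p"
      have Vx: "?V ?x = ?u" using chart_inv_left[OF p] by simp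
      have xN: "?x \<in> snd \<kappa> ` N" using N by simp
      have V: "?V differentiable (at ?x)" using sm[OF i] xN by (rule smooth_on_differentiable)
      have F: "?F differentiable (at y)" if "y \<in> snd \<kappa> ` N" for y
        using f N that by (intro smooth_on_differentiable[OF f]) auto
      have "dir_deriv \<kappa> (\<lambda>q. dir_deriv \<kappa> f q (v i q)) p ?u = dd ?u (\<lambda>y. dd (?V y) ?F y) ?x"
        by (rule dir_deriv_local[OF p]) (simp add: dir_deriv_def chart_inv_left)
      also have "\<dots> = dd ?u (dd (?V ?x) ?F) ?x + dd (dd ?u ?V ?x) ?F ?x"
        by (rule dd_eqI, rule linear_field_has_derivative[OF oN xN dd_linear[OF F]
            smooth_on_differentiable[OF smooth_on_dd[OF f] x] V])
      finally have 1: "dir_deriv \<kappa> (\<lambda>q. dir_deriv \<kappa> f q (v i q)) p ?u =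
        dd ?u (dd ?u ?F) ?x + dd (dd ?u ?V ?x) ?F ?x" unfolding Vx .
      have 2: "dir_deriv \<kappa> f p (nabla \<kappa> g p ?u (v i)) =
        dd (dd ?u ?V ?x) ?F ?x + dd (christoffel ?G ?x ?u ?u) ?F ?x"
        by (simp add: dir_deriv_def nabla_def levi_civita_form_local[OF p] linear_add[OF dd_linear[OF F[OF xN]]])
      show ?thesis unfolding 1 2 hess_def by simp
    qed
    then have "?r v = - (\<Sum>i<DIM('e). hess ?G ?F ?x (v i p) (v i p))"
      by (simp add: sum_negf)
    also have "\<dots> = - (\<Sum>i<DIM('e). hess ?G ?F ?x (e i) (e i))"
      using inner_form.trace_eq[OF form on e bil] by simp
    finally show ?thesis .
  qed
  \<comment> \<open>Existence is needed besides uniqueness, since the Laplacian is a definite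
    description.\<close>
  have "\<exists>v. local_orthonormal_frame \<kappa> g p v"
  proof (rule smooth_orthonormal_frame[OF chart_open(2) G])
    fix w assume w: "\<And>i. i < DIM('e) \<Longrightarrow> smooth_on (snd \<kappa> ` fst \<kappa>) (w i)"
      and on: "\<And>x. x \<in> snd \<kappa> ` fst \<kappa> \<Longrightarrow> orthonormal_basis (g \<kappa> (chart_inv \<kappa> x)) (\<lambda>i. w i x)"
    have "smooth_on (snd \<kappa> ` fst \<kappa>) ((\<lambda>q. w i (snd \<kappa> q)) \<circ> chart_inv \<kappa>)" if "i < DIM('e)" for i
      by (rule smooth_on_cong[THEN iffD2, OF chart_open(2) _ w[OF that]]) (simp add: chart_inv_right)
    moreover have "orthonormal_basis (g \<kappa> q) (\<lambda>i. w i (snd \<kappa> q))" if "q \<in> fst \<kappa>" for q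
      using on[of "snd \<kappa> q"] that chart_inv_left by simp
    ultimately have "local_orthonormal_frame \<kappa> g p (\<lambda>i q. w i (snd \<kappa> q))"
      unfolding local_orthonormal_frame_def using p chart_open(1) by (intro exI[of _ "fst \<kappa>"]) auto
    then show ?thesis by blast
  qed
  then obtain v where v: "local_orthonormal_frame \<kappa> g p v" by blast
  show ?thesis
    unfolding laplacian_def
  proof (rule the_equality)
    show "\<exists>v. local_orthonormal_frame \<kappa> g p v \<and>
        - (\<Sum>i<DIM('e). hess ?G ?F ?x (e i) (e i)) = ?r v"
      using v frame[OF v] by (intro exI[of _ v]) simp
  qed (use frame in auto)
qed

end

section \<open>Complex space forms and product charts\<close>

lemma riemannian_chart:
  assumes "riemannian_manifold A g" "\<kappa> \<in> A"
  shows "is_chart \<kappa>" "metric_on (snd \<kappa> ` fst \<kappa>) (\<lambda>y. g \<kappa> (chart_inv \<kappa> y))"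
proof -
  show \<kappa>: "is_chart \<kappa>"
    using assms by (simp add: riemannian_manifold_def smooth_atlas_def)
  have "inner_form (g \<kappa> p)" if "p \<in> fst \<kappa>" for p
    using assms that unfolding riemannian_manifold_def inner_form_def by blast
  then show "metric_on (snd \<kappa> ` fst \<kappa>) (\<lambda>y. g \<kappa> (chart_inv \<kappa> y))"
    using assms chart_inv_into[OF \<kappa>] unfolding metric_on_def riemannian_manifold_def by blast
qed

text \<open>An instance of \<open>constant_holomorphic_curvature\<close>; the invariance of the
  curvature under J comes from J being parallel and orthogonal.\<close>

lemma complex_space_form_curvature:
  assumes N: "complex_space_form A g J c" and \<kappa>: "\<kappa> \<in> A" and p: "p \<in> fst \<kappa>"
  shows "g \<kappa> p (riem (\<lambda>y. g \<kappa> (chart_inv \<kappa> y)) (snd \<kappa> p) u v v) u =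
    c / 4 * (g \<kappa> p u u * g \<kappa> p v v - (g \<kappa> p u v)\<^sup>2 + 3 * (g \<kappa> p u (J \<kappa> p v))\<^sup>2)"
proof -
  have K: "kaehler_manifold A g J" using N by (simp add: complex_space_form_def)
  then have R: "riemannian_manifold A g" and JJ: "almost_complex_structure A J"
    by (simp_all add: kaehler_manifold_def)
  let ?G = "\<lambda>y. g \<kappa> (chart_inv \<kappa> y)" and ?x = "snd \<kappa> p" and ?S = "snd \<kappa> ` fst \<kappa>"
  let ?J = "\<lambda>y. J \<kappa> (chart_inv \<kappa> y)"
  note ch = riemannian_chart(1)[OF R \<kappa>] and G = riemannian_chart(2)[OF R \<kappa>]
  note S = chart_open(2)[OF ch] and inv = chart_inv_left[OF ch p]
  have x: "?x \<in> ?S" using p by simp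
  interpret inner_form "g \<kappa> p" using metric_on_form[OF S G x] by (simp add: inv)
  have J: "linear (J \<kappa> q)" "J \<kappa> q (J \<kappa> q u) = - u" "smooth_on ?S (\<lambda>x. ?J x u)"
    "g \<kappa> q (J \<kappa> q u) (J \<kappa> q v) = g \<kappa> q u v" if "q \<in> fst \<kappa>" for q u v
    using JJ K \<kappa> that unfolding almost_complex_structure_def kaehler_manifold_def by blast+
  have par: "dd u (\<lambda>y. ?J y w) y + christoffel ?G y u (?J y w) = ?J y (christoffel ?G y u w)"
    if y: "y \<in> ?S" for y u w
  proof -
    note q = chart_inv_into[OF ch y]
    have "nabla \<kappa> g (chart_inv \<kappa> y) u (\<lambda>q. J \<kappa> q w) - ?J y (nabla \<kappa> g (chart_inv \<kappa> y) u (\<lambda>_. w)) = 0"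
      using K \<kappa> q unfolding kaehler_manifold_def by blast
    then show ?thesis
      by (simp add: nabla_const_local[OF ch q] nabla_def levi_civita_form_local[OF ch q]
        chart_inv_right[OF ch y] dir_deriv_def comp_def)
  qed
  have rJ: "riem ?G ?x u v (J \<kappa> p w) = J \<kappa> p (riem ?G ?x u v w)" for u v w
    using riem_parallel_endo[where J = ?J, OF S G J(1)[OF chart_inv_into[OF ch]] J(3)[OF p] par x]
    by (simp add: inv)
  note rl = riem_linear[OF S G x]
  note skew = riem_skew[OF S G x, unfolded inv]
  show ?thesis
  proof (rule constant_holomorphic_curvature[where R = "\<lambda>u v w z. g \<kappa> p (riem ?G ?x u v w) z"])
    show "linear (J \<kappa> p)" "\<And>u. J \<kappa> p (J \<kappa> p u) = - u" "\<And>u v. g \<kappa> p (J \<kappa> p u) (J \<kappa> p v) = g \<kappa> p u v"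
      using J[OF p] by blast+
    show "linear (\<lambda>u. g \<kappa> p (riem ?G ?x u v w) z)" "linear (\<lambda>v. g \<kappa> p (riem ?G ?x u v w) z)"
      "linear (\<lambda>w. g \<kappa> p (riem ?G ?x u v w) z)" "linear (g \<kappa> p (riem ?G ?x u v w))" for u v w z
      using rl[THEN linear_add] rl[THEN linear_cmul] by (auto intro!: linearI simp: form_simps)
    show "g \<kappa> p (riem ?G ?x u v w) z = - g \<kappa> p (riem ?G ?x v u w) z" for u v w z
      using riem_antisym[of ?G ?x u v w] by (simp add: minus_left)
    show "g \<kappa> p (riem ?G ?x u v w) z = - g \<kappa> p (riem ?G ?x u v z) w" for u v w z
      using skew[of u v w z] sym by simp
    show "g \<kappa> p (riem ?G ?x u v w) z + g \<kappa> p (riem ?G ?x v w u) z + g \<kappa> p (riem ?G ?x w u v) z = 0" for u v w z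
      using riem_bianchi[OF S G x, of u v w] by (simp add: add_left[symmetric] zero_left)
    show "g \<kappa> p (riem ?G ?x u v (J \<kappa> p w)) (J \<kappa> p z) = g \<kappa> p (riem ?G ?x u v w) z" for u v w z
      by (simp add: rJ J(4)[OF p])
    show "g \<kappa> p (riem ?G ?x u (J \<kappa> p u) (J \<kappa> p u)) u = c * (g \<kappa> p u u)\<^sup>2" for u
    proof (cases "u = 0")
      case True
      then show ?thesis by (simp add: zero_right)
    next
      case False
      \<comment> \<open>A vector is orthogonal to its image under J, so the denominator of the
        sectional curvature is the square of g(u,u).\<close>
      have "g \<kappa> p u (J \<kappa> p u) = - g \<kappa> p u (J \<kappa> p u)"
        using J(4)[OF p, of u "J \<kappa> p u"] J(2)[OF p, of u] sym[of "J \<kappa> p u" u] by (simp add: minus_right)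
      then have "g \<kappa> p u (J \<kappa> p u) = 0" by simp
      moreover have "sectional_curvature \<kappa> g p u (J \<kappa> p u) = c"
        using N \<kappa> p False by (simp add: complex_space_form_def)
      ultimately show ?thesis
        using pos[OF False]
        by (simp add: sectional_curvature_def curvature_local[OF ch p] J(4)[OF p] power2_eq_square field_simps)
    qed
  qed
qed

text \<open>\<open>chart_inv\<close> is chosen by \<open>inv_into\<close>; injectivity of the
  product map forces it to be the pair of inverses, but on the image only.\<close>

lemma is_chart_prod:
  fixes \<kappa> :: "('a::topological_space, 'e::euclidean_space) chart"
    and \<kappa>' :: "('b::topological_space, 'f::euclidean_space) chart"
  assumes \<kappa>: "is_chart \<kappa>" and \<kappa>': "is_chart \<kappa>'"
  shows "is_chart (prod_chart \<kappa> \<kappa>')"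
    and "z \<in> (snd \<kappa> ` fst \<kappa>) \<times> (snd \<kappa>' ` fst \<kappa>') \<Longrightarrow>
      chart_inv (prod_chart \<kappa> \<kappa>') z = (chart_inv \<kappa> (fst z), chart_inv \<kappa>' (snd z))"
proof -
  let ?P = "prod_chart \<kappa> \<kappa>'" and ?U = "(snd \<kappa> ` fst \<kappa>) \<times> (snd \<kappa>' ` fst \<kappa>')"
  let ?inv = "\<lambda>z. (chart_inv \<kappa> (fst z), chart_inv \<kappa>' (snd z))"
  have P: "fst ?P = fst \<kappa> \<times> fst \<kappa>'" "snd ?P = (\<lambda>q. (snd \<kappa> (fst q), snd \<kappa>' (snd q)))"
    by (auto simp: prod_chart_def map_prod_def)
  have im: "snd ?P ` fst ?P = ?U" by (force simp: P)
  have left: "?inv (snd ?P q) = q" if "q \<in> fst ?P" for q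
    using that chart_inv_left[OF \<kappa>] chart_inv_left[OF \<kappa>'] by (auto simp: P)
  have right: "snd ?P (?inv z) = z" "?inv z \<in> fst ?P" if "z \<in> ?U" for z
    using that chart_inv_right[OF \<kappa>] chart_inv_right[OF \<kappa>'] chart_inv_into[OF \<kappa>] chart_inv_into[OF \<kappa>']
    by (auto simp: P)
  have inj: "inj_on (snd ?P) (fst ?P)" using left by (rule inj_on_inverseI)
  have inv: "chart_inv ?P z = ?inv z" if "z \<in> ?U" for z
    unfolding chart_inv_def using inv_into_f_f[OF inj right(2)[OF that]] right(1)[OF that]
    by (simp add: chart_inv_def)
  then show "z \<in> ?U \<Longrightarrow> chart_inv ?P z = ?inv z" .
  have c: "continuous_on (fst \<kappa>) (snd \<kappa>)" "continuous_on (fst \<kappa>') (snd \<kappa>')"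
    "continuous_on (snd \<kappa> ` fst \<kappa>) (chart_inv \<kappa>)" "continuous_on (snd \<kappa>' ` fst \<kappa>') (chart_inv \<kappa>')"
    using \<kappa> \<kappa>' by (auto simp: is_chart_def homeomorphism_def)
  have "homeomorphism (fst ?P) ?U (snd ?P) (chart_inv ?P)"
  proof (rule homeomorphismI)
    show "continuous_on (fst ?P) (snd ?P)"
      unfolding P by (intro continuous_on_Pair continuous_on_compose2[OF c(1)]
        continuous_on_compose2[OF c(2)] continuous_intros) auto
    have "continuous_on ?U ?inv"
      by (intro continuous_on_Pair continuous_on_compose2[OF c(3)]
        continuous_on_compose2[OF c(4)] continuous_intros) auto
    then show "continuous_on ?U (chart_inv ?P)"
      using inv by (simp cong: continuous_on_cong)
    show "snd ?P ` fst ?P \<subseteq> ?U" using im by simp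
    show "chart_inv ?P ` ?U \<subseteq> fst ?P" using inv right(2) by auto
    show "chart_inv ?P (snd ?P q) = q" if "q \<in> fst ?P" for q
      using inv[OF imageI[OF that, of "snd ?P", unfolded im]] left[OF that] by simp
    show "snd ?P (chart_inv ?P z) = z" if "z \<in> ?U" for z
      using inv right(1) that by simp
  qed
  then show "is_chart ?P"
    unfolding is_chart_def im
    using chart_open[OF \<kappa>] chart_open[OF \<kappa>'] by (auto simp: P intro: open_Times)
qed

section \<open>The second fundamental form and its invariants in charts\<close>

lemma christoffel_cong:
  assumes "open S" "x \<in> S" "\<And>y. y \<in> S \<Longrightarrow> G y = G' y"
  shows "christoffel G x = christoffel G' x"
proof -
  have "dd u (\<lambda>y. G y v w) x = dd u (\<lambda>y. G' y v w) x" for u v w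
    by (rule dd_cong_open[OF assms(1,2)]) (simp add: assms(3))
  then show ?thesis using assms(2,3) by (simp add: christoffel_def is_levi_civita_def)
qed

lemma second_fundamental_form_local:
  assumes \<kappa>: "is_chart \<kappa>" and \<kappa>': "is_chart \<kappa>'" and p: "p \<in> fst \<kappa>" "\<psi> p \<in> fst \<kappa>'"
    and W: "open S" "snd \<kappa> p \<in> S" "\<And>y. y \<in> S \<Longrightarrow> g \<kappa> (chart_inv \<kappa> y) = W y"
  shows "second_fundamental_form \<kappa> g \<kappa>' g' \<psi> p =
    sff (\<lambda>y. g' \<kappa>' (chart_inv \<kappa>' y)) W (snd \<kappa>' \<circ> \<psi> \<circ> chart_inv \<kappa>) (snd \<kappa> p)"
proof (intro ext)
  fix u v
  let ?\<Phi> = "snd \<kappa>' \<circ> \<psi> \<circ> chart_inv \<kappa>"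
  have d: "differential \<kappa> \<kappa>' \<psi> q w = dd w ?\<Phi> (snd \<kappa> q)" for q w
    by (simp add: differential_def dir_deriv_def comp_assoc)
  have "dir_deriv \<kappa> (\<lambda>q. differential \<kappa> \<kappa>' \<psi> q v) p u = dd u (dd v ?\<Phi>) (snd \<kappa> p)"
    by (rule dir_deriv_local[OF \<kappa> p(1), of "\<lambda>q. differential \<kappa> \<kappa>' \<psi> q v" "dd v ?\<Phi>", OF d])
  moreover have "?\<Phi> (snd \<kappa> p) = snd \<kappa>' (\<psi> p)"
    by (simp add: chart_inv_left[OF \<kappa> p(1)])
  moreover have "christoffel (\<lambda>y. g \<kappa> (chart_inv \<kappa> y)) (snd \<kappa> p) = christoffel W (snd \<kappa> p)"
    by (rule christoffel_cong[OF W])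
  ultimately show "second_fundamental_form \<kappa> g \<kappa>' g' \<psi> p u v =
      sff (\<lambda>y. g' \<kappa>' (chart_inv \<kappa>' y)) W ?\<Phi> (snd \<kappa> p) u v"
    by (simp add: second_fundamental_form_def nabla_along_def sff_def cov_def d
        levi_civita_form_local[OF \<kappa>' p(2)] nabla_const_local[OF \<kappa> p(1)])
qed

lemma mean_curvature_vector_eq:
  fixes \<kappa> :: "('a::topological_space, 'e::euclidean_space) chart"
  assumes "inner_form (g \<kappa> p)" "orthonormal_basis (g \<kappa> p) e"
    and h: "bilinear (second_fundamental_form \<kappa> g \<kappa>' g' \<psi> p)"
  shows "mean_curvature_vector \<kappa> g \<kappa>' g' \<psi> p = (1 / real DIM('e)) *\<^sub>R
    (\<Sum>i<DIM('e). second_fundamental_form \<kappa> g \<kappa>' g' \<psi> p (e i) (e i))"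
  unfolding mean_curvature_vector_def
proof (rule the_equality)
  fix H assume "\<exists>e. orthonormal_basis (g \<kappa> p) e \<and> H = (1 / real DIM('e)) *\<^sub>R
    (\<Sum>i<DIM('e). second_fundamental_form \<kappa> g \<kappa>' g' \<psi> p (e i) (e i))"
  then obtain e' where e': "orthonormal_basis (g \<kappa> p) e'" and H: "H = (1 / real DIM('e)) *\<^sub>R
    (\<Sum>i<DIM('e). second_fundamental_form \<kappa> g \<kappa>' g' \<psi> p (e' i) (e' i))" by blast
  show "H = (1 / real DIM('e)) *\<^sub>R
    (\<Sum>i<DIM('e). second_fundamental_form \<kappa> g \<kappa>' g' \<psi> p (e i) (e i))"
    unfolding H inner_form.trace_eq[OF assms(1) e' assms(2) h] ..
qed (use assms(2) in blast)

text \<open>The double sum is a trace in each index separately, so \<open>trace_eq\<close> changes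
  the basis for one index while the other is held fixed.\<close>

lemma second_fundamental_form_norm2_eq:
  fixes \<kappa> :: "('a::topological_space, 'e::euclidean_space) chart"
    and \<kappa>' :: "('b::topological_space, 'n::euclidean_space) chart"
  assumes form: "inner_form (g \<kappa> p)" and form': "inner_form (g' \<kappa>' (\<psi> p))"
    and e: "orthonormal_basis (g \<kappa> p) e"
    and h: "bilinear (second_fundamental_form \<kappa> g \<kappa>' g' \<psi> p)"
  defines "h \<equiv> second_fundamental_form \<kappa> g \<kappa>' g' \<psi> p"
  shows "second_fundamental_form_norm2 \<kappa> g \<kappa>' g' \<psi> p =
    (\<Sum>i<DIM('e). \<Sum>j<DIM('e). g' \<kappa>' (\<psi> p) (h (e i) (e j)) (h (e i) (e j)))"
proof -
  interpret Q: inner_form "g' \<kappa>' (\<psi> p)" by (rule form')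
  let ?Q = "g' \<kappa>' (\<psi> p)"
  have b: "bilinear h" using h by (simp add: h_def)
  note simps = bilinear_ladd[OF b] bilinear_radd[OF b] bilinear_lmul[OF b] bilinear_rmul[OF b] Q.form_simps
  have eq: "(\<Sum>i<DIM('e). \<Sum>j<DIM('e). ?Q (h (e' i) (e' j)) (h (e' i) (e' j))) =
      (\<Sum>i<DIM('e). \<Sum>j<DIM('e). ?Q (h (e i) (e j)) (h (e i) (e j)))"
    if e': "orthonormal_basis (g \<kappa> p) e'" for e'
  proof -
    have "(\<Sum>i<DIM('e). \<Sum>j<DIM('e). ?Q (h (e' i) (e' j)) (h (e' i) (e' j))) =
        (\<Sum>i<DIM('e). \<Sum>j<DIM('e). ?Q (h (e' i) (e j)) (h (e' i) (e j)))"
      by (intro sum.cong refl inner_form.trace_eq[OF form e' e] bilinearI_linear linearI) (simp_all add: simps)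
    also have "\<dots> = (\<Sum>j<DIM('e). \<Sum>i<DIM('e). ?Q (h (e' i) (e j)) (h (e' i) (e j)))"
      by (rule sum.swap)
    also have "\<dots> = (\<Sum>j<DIM('e). \<Sum>i<DIM('e). ?Q (h (e i) (e j)) (h (e i) (e j)))"
      by (intro sum.cong refl inner_form.trace_eq[OF form e' e] bilinearI_linear linearI) (simp_all add: simps)
    also have "\<dots> = (\<Sum>i<DIM('e). \<Sum>j<DIM('e). ?Q (h (e i) (e j)) (h (e i) (e j)))"
      by (rule sum.swap)
    finally show ?thesis .
  qed
  show ?thesis
    unfolding second_fundamental_form_norm2_def h_def[symmetric]
  proof (rule the_equality)
    show "\<exists>e'. orthonormal_basis (g \<kappa> p) e' \<and>
      (\<Sum>i<DIM('e). \<Sum>j<DIM('e). ?Q (h (e i) (e j)) (h (e i) (e j))) =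
      (\<Sum>i<DIM('e). \<Sum>j<DIM('e). ?Q (h (e' i) (e' j)) (h (e' i) (e' j)))"
      using e by blast
  qed (use eq in auto)
qed

theorem theorem3p5:
  fixes B :: "('b::{t2_space,second_countable_topology}, 'e::euclidean_space) atlas"
    and F :: "('c::{t2_space,second_countable_topology}, 'f::euclidean_space) atlas"
    and N :: "('d::{t2_space,second_countable_topology}, 'n::euclidean_space) atlas"
    and gB :: "('b, 'e) metric" and gF :: "('c, 'f) metric"
    and g :: "('b \<times> 'c, 'e \<times> 'f) metric"
    and gN :: "('d, 'n) metric" and J :: "('d, 'n) endo_field"
    and f :: "'b \<Rightarrow> real" and c :: real and \<psi> :: "'b \<times> 'c \<Rightarrow> 'd"
  assumes "riemannian_manifold B gB"
    and "riemannian_manifold F gF"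
    and "smooth_function B f" and "\<forall>b\<in>carrier_of B. f b > 0"
    and "warped_product_metric B gB F gF f g"
    and "complex_space_form N gN J c"
    and "isometric_immersion (prod_atlas B F) g N gN \<psi>"
  shows "\<forall>\<kappa>B\<in>B. \<forall>\<kappa>F\<in>F. \<forall>\<kappa>N\<in>N. \<forall>b\<in>fst \<kappa>B. \<forall>x\<in>fst \<kappa>F. \<psi> (b, x) \<in> fst \<kappa>N \<longrightarrow>
    (let m1 = real DIM('e); m2 = real DIM('f); m = m1 + m2;
         \<Delta>f = laplacian \<kappa>B gB f b;
         H2 = mean_curvature_norm2 (prod_chart \<kappa>B \<kappa>F) g \<kappa>N gN \<psi> (b, x);
         h2 = second_fundamental_form_norm2 (prod_chart \<kappa>B \<kappa>F) g \<kappa>N gN \<psi> (b, x)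
     in (c \<ge> 0 \<longrightarrow>
           m1 * m\<^sup>2 / (2 * (m - 1)) * H2 - m1 / 2 * h2 + m1 * (c / 4) \<le> \<Delta>f / f b \<and>
           \<Delta>f / f b \<le> m\<^sup>2 / (4 * m2) * H2 + m1 * c) \<and>
        (c < 0 \<longrightarrow>
           m1 * m\<^sup>2 / (2 * (m - 1)) * H2 - m1 / 2 * h2 + m1 * c \<le> \<Delta>f / f b \<and>
           \<Delta>f / f b \<le> m\<^sup>2 / (4 * m2) * H2 + m1 * (c / 4)))"
proof (intro ballI impI)
  fix \<kappa>B \<kappa>F \<kappa>N b x
  assume \<kappa>B: "\<kappa>B \<in> B" and \<kappa>F: "\<kappa>F \<in> F" and \<kappa>N: "\<kappa>N \<in> N"
    and b: "b \<in> fst \<kappa>B" and x: "x \<in> fst \<kappa>F" and \<psi>p: "\<psi> (b, x) \<in> fst \<kappa>N"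
  define \<kappa> where "\<kappa> = prod_chart \<kappa>B \<kappa>F"
  define p where "p = (b, x)"
  define SB where "SB = snd \<kappa>B ` fst \<kappa>B"
  define SF where "SF = snd \<kappa>F ` fst \<kappa>F"
  define S where "S = snd \<kappa>N ` fst \<kappa>N"
  define GB where "GB = (\<lambda>y. gB \<kappa>B (chart_inv \<kappa>B y))"
  define GF where "GF = (\<lambda>z. gF \<kappa>F (chart_inv \<kappa>F z))"
  define G where "G = (\<lambda>y. gN \<kappa>N (chart_inv \<kappa>N y))"
  define fc where "fc = f \<circ> chart_inv \<kappa>B"
  define W where "W = warped GB GF fc"
  define \<Phi> where "\<Phi> = snd \<kappa>N \<circ> \<psi> \<circ> chart_inv \<kappa>"
  define T where "T = snd \<kappa> ` {q \<in> fst \<kappa>. \<psi> q \<in> fst \<kappa>N}"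
  have RN: "riemannian_manifold N gN"
    using assms(6) by (simp add: complex_space_form_def kaehler_manifold_def)
  note chB = riemannian_chart(1)[OF assms(1) \<kappa>B] and GB = riemannian_chart(2)[OF assms(1) \<kappa>B, folded SB_def GB_def]
  note chF = riemannian_chart(1)[OF assms(2) \<kappa>F] and GF = riemannian_chart(2)[OF assms(2) \<kappa>F, folded SF_def GF_def]
  note chN = riemannian_chart(1)[OF RN \<kappa>N] and G = riemannian_chart(2)[OF RN \<kappa>N, folded S_def G_def]
  note ch = is_chart_prod(1)[OF chB chF, folded \<kappa>_def]
  note inv = is_chart_prod(2)[OF chB chF, folded \<kappa>_def SB_def SF_def]
  have fst\<kappa>: "fst \<kappa> = fst \<kappa>B \<times> fst \<kappa>F" and snd\<kappa>: "snd \<kappa> q = (snd \<kappa>B (fst q), snd \<kappa>F (snd q))" for q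
    by (simp_all add: \<kappa>_def prod_chart_def map_prod_def case_prod_beta)
  have \<kappa>_in: "\<kappa> \<in> prod_atlas B F" unfolding \<kappa>_def prod_atlas_def using \<kappa>B \<kappa>F by blast
  have p: "p \<in> fst \<kappa>" "\<psi> p \<in> fst \<kappa>N" using b x \<psi>p by (simp_all add: p_def fst\<kappa>)
  have fpos: "f q > 0" if "q \<in> fst \<kappa>B" for q
    using assms(4) \<kappa>B that by (auto simp: carrier_of_def)
  have oT: "open T"
  proof -
    have "continuous_on (fst \<kappa>) \<psi>"
      using assms(7) \<kappa>_in
      by (auto simp: isometric_immersion_def smooth_map_def carrier_of_def intro: continuous_on_subset)
    then have "open (fst \<kappa> \<inter> \<psi> -` fst \<kappa>N)"
      using chart_open(1)[OF ch] chart_open(1)[OF chN] continuous_on_open_vimage by (metis Int_commute)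
    moreover have "fst \<kappa> \<inter> \<psi> -` fst \<kappa>N = {q \<in> fst \<kappa>. \<psi> q \<in> fst \<kappa>N}" by auto
    ultimately show ?thesis unfolding T_def by (intro chart_open_image[OF ch]) auto
  qed
  have TS: "T \<subseteq> SB \<times> SF" by (auto simp: T_def SB_def SF_def fst\<kappa> snd\<kappa>)
  \<comment> \<open>The equality holds on the coordinate domain only; openness of the domain makes
    that enough for the Christoffel forms to agree there.\<close>
  have gW: "g \<kappa> (chart_inv \<kappa> y) = W y" if "y \<in> SB \<times> SF" for y
  proof (intro ext)
    fix u v
    have q: "chart_inv \<kappa>B (fst y) \<in> fst \<kappa>B" "chart_inv \<kappa>F (snd y) \<in> fst \<kappa>F"
      using that chart_inv_into[OF chB] chart_inv_into[OF chF] by (auto simp: SB_def SF_def)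
    show "g \<kappa> (chart_inv \<kappa> y) u v = W y u v"
      unfolding inv[OF that] unfolding \<kappa>_def
      using assms(5)[unfolded warped_product_metric_def, rule_format, OF \<kappa>B \<kappa>F q]
      by (simp add: W_def warped_def GB_def GF_def fc_def)
  qed
  have \<psi>_iso: "\<forall>\<kappa>\<in>prod_atlas B F. \<forall>\<kappa>'\<in>N. \<forall>p\<in>fst \<kappa>. \<psi> p \<in> fst \<kappa>' \<longrightarrow>
      (\<forall>u v. g \<kappa> p u v = gN \<kappa>' (\<psi> p) (differential \<kappa> \<kappa>' \<psi> p u) (differential \<kappa> \<kappa>' \<psi> p v))"
    using assms(7) unfolding isometric_immersion_def by blast
  interpret warped_immersion_coords SB GB SF GF fc S G T \<Phi>
  proof
    show "open SB" "open SF" "open S"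
      using chart_open(2) chB chF chN by (simp_all add: SB_def SF_def S_def)
    show "metric_on SB GB" "metric_on SF GF" "metric_on S G" by fact+
    show "smooth_on SB fc"
      using assms(3) \<kappa>B by (simp add: smooth_function_def SB_def fc_def)
    show "fc y > 0" if "y \<in> SB" for y
      using fpos chart_inv_into[OF chB] that by (simp add: fc_def SB_def)
    show "open T" "T \<subseteq> SB \<times> SF" by fact+
    show "smooth_on T \<Phi>"
      using assms(7) \<kappa>_in \<kappa>N unfolding isometric_immersion_def smooth_map_def T_def \<Phi>_def by blast
    show "\<Phi> y \<in> S" if "y \<in> T" for y
      using that chart_inv_left[OF ch] by (auto simp: T_def \<Phi>_def S_def)
    show "G (\<Phi> y) (dd u \<Phi> y) (dd v \<Phi> y) = warped GB GF fc y u v" if yT: "y \<in> T" for y u v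
    proof -
      obtain q where q: "q \<in> fst \<kappa>" "\<psi> q \<in> fst \<kappa>N" "y = snd \<kappa> q" using yT unfolding T_def by blast
      have y: "chart_inv \<kappa> y = q" using q chart_inv_left[OF ch] by simp
      have "chart_inv \<kappa>N (\<Phi> y) = \<psi> q" using y q(2) chart_inv_left[OF chN] by (simp add: \<Phi>_def)
      moreover have "W y u v = g \<kappa> q u v" using gW[of y] TS that y by auto
      ultimately show ?thesis
        using \<psi>_iso \<kappa>_in \<kappa>N q
        by (simp add: G_def W_def[symmetric] \<Phi>_def differential_def dir_deriv_def comp_assoc)
    qed
  qed
  let ?y = "snd \<kappa> p"
  have "?y \<in> T" unfolding T_def using p by blast
  then have y: "?y \<in> T" "?y \<in> SB \<times> SF" "fst ?y = snd \<kappa>B b" "snd ?y = snd \<kappa>F x"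
    using TS by (auto simp: snd\<kappa> p_def)
  have \<Phi>y: "\<Phi> ?y = snd \<kappa>N (\<psi> p)" by (simp add: \<Phi>_def chart_inv_left[OF ch p(1)])
  have Gy: "G (\<Phi> ?y) = gN \<kappa>N (\<psi> p)" by (simp add: G_def \<Phi>y chart_inv_left[OF chN p(2)])
  have Wy: "W ?y = g \<kappa> p" using gW[OF y(2)] chart_inv_left[OF ch p(1)] by simp
  have GBy: "GB (fst ?y) = gB \<kappa>B b" by (simp add: GB_def y chart_inv_left[OF chB b])
  have GFy: "GF (snd ?y) = gF \<kappa>F x" by (simp add: GF_def y chart_inv_left[OF chF x])
  have fy: "fc (fst ?y) = f b" by (simp add: fc_def y chart_inv_left[OF chB b])
  interpret Q: inner_form "gN \<kappa>N (\<psi> p)"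
    using metric_on_form[OF S G \<Phi>_into[OF y(1)]] unfolding Gy .
  interpret M: inner_form "g \<kappa> p"
    using warped_form[OF y(2)] unfolding W_def[symmetric] Wy .
  interpret MB: inner_form "gB \<kappa>B b" using formB[of "fst ?y"] y(2) unfolding GBy by auto
  interpret MF: inner_form "gF \<kappa>F x" using formF[of "snd ?y"] y(2) unfolding GFy by auto
  let ?h = "second_fundamental_form \<kappa> g \<kappa>N gN \<psi> p"
  have h: "?h = sff G W \<Phi> ?y"
    unfolding G_def \<Phi>_def by (rule second_fundamental_form_local[where \<psi> = \<psi> and g = g and W = W, OF ch chN p open_product y(2) gW])
  have hbil: "bilinear ?h" unfolding h W_def by (rule sff_bilinear[OF y(1)])
  have hsym: "?h u v = ?h v u" for u v unfolding h W_def by (rule sff_sym[OF y(1)])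
  obtain eB where eB: "orthonormal_basis (gB \<kappa>B b) eB" using MB.orthonormal_basis_exists .
  obtain eF where eF: "orthonormal_basis (gF \<kappa>F x) eF" using MF.orthonormal_basis_exists .
  let ?m1 = "DIM('e)" and ?m2 = "DIM('f)"
  \<comment> \<open>A vertical vector (0,t) has squared length f^2 gF(t,t), hence the factor 1/f in
    front of a basis that is orthonormal for gF.\<close>
  define e where "e i = (if i < ?m1 then (eB i, 0) else (0, (1 / f b) *\<^sub>R eF (i - ?m1)))" for i
  have gp: "g \<kappa> p u v = gB \<kappa>B b (fst u) (fst v) + (f b)\<^sup>2 * gF \<kappa>F x (snd u) (snd v)" for u v
    unfolding Wy[symmetric] by (simp add: W_def warped_def GBy GFy fy)
  have fb: "f b > 0" by (rule fpos[OF b])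
  have e: "orthonormal_basis (g \<kappa> p) e"
  proof -
    have "g \<kappa> p (e i) (e j) = (if i = j then 1 else 0)" if "i < ?m1 + ?m2" "j < ?m1 + ?m2" for i j
      using that eB eF fb
      by (auto simp: gp e_def orthonormal_basis_def MB.form_simps MF.form_simps power2_eq_square)
    then show ?thesis by (simp add: orthonormal_basis_def)
  qed
  define X where "X i = dd (e i) \<Phi> ?y" for i
  have X: "gN \<kappa>N (\<psi> p) (X i) (X j) = (if i = j then 1 else 0)" if "i < ?m1 + ?m2" "j < ?m1 + ?m2" for i j
    using isometric[OF y(1)] e that unfolding X_def W_def[symmetric] Wy Gy
    by (simp add: orthonormal_basis_def)
  \<comment> \<open>The ambient sectional curvature of the plane spanned by the orthonormal pair X
    i, X j.\<close>
  define K where "K i j = gN \<kappa>N (\<psi> p) (riem G (\<Phi> ?y) (X i) (X j) (X j)) (X i)" for i j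
  have K: "K i j = c / 4 * (1 + 3 * (gN \<kappa>N (\<psi> p) (X i) (J \<kappa>N (\<psi> p) (X j)))\<^sup>2)"
    "(gN \<kappa>N (\<psi> p) (X i) (J \<kappa>N (\<psi> p) (X j)))\<^sup>2 \<le> 1"
    if "i < ?m1" "?m1 \<le> j" "j < ?m1 + ?m2" for i j
  proof -
    show "K i j = c / 4 * (1 + 3 * (gN \<kappa>N (\<psi> p) (X i) (J \<kappa>N (\<psi> p) (X j)))\<^sup>2)"
      using complex_space_form_curvature[OF assms(6) \<kappa>N p(2), of "X i" "X j"] X[of i i] X[of i j] X[of j j] that
      unfolding K_def \<Phi>y G_def by simp
    have "gN \<kappa>N (\<psi> p) (J \<kappa>N (\<psi> p) (X j)) (J \<kappa>N (\<psi> p) (X j)) = 1"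
      using assms(6) \<kappa>N p(2) X[of j j] that by (simp add: complex_space_form_def kaehler_manifold_def)
    then show "(gN \<kappa>N (\<psi> p) (X i) (J \<kappa>N (\<psi> p) (X j)))\<^sup>2 \<le> 1"
      using Q.cauchy_schwarz[of "X i" "J \<kappa>N (\<psi> p) (X j)"] X[of i i] that by simp
  qed
  have lap: "laplacian \<kappa>B gB f b = - (\<Sum>i<?m1. hess GB fc (snd \<kappa>B b) (eB i) (eB i))"
    unfolding GB_def fc_def
    using assms(3) \<kappa>B
    by (intro laplacian_local[where g = gB, OF chB riemannian_chart(2)[OF assms(1) \<kappa>B] _ b eB])
      (simp add: smooth_function_def)
  have L: "laplacian \<kappa>B gB f b / f b = (\<Sum>i<?m1. K i j + gN \<kappa>N (\<psi> p) (?h (e i) (e i)) (?h (e j) (e j)) -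
      gN \<kappa>N (\<psi> p) (?h (e i) (e j)) (?h (e i) (e j)))" if j: "?m1 \<le> j" "j < ?m1 + ?m2" for j
  proof -
    have "K i j + gN \<kappa>N (\<psi> p) (?h (e i) (e i)) (?h (e j) (e j)) -
      gN \<kappa>N (\<psi> p) (?h (e i) (e j)) (?h (e i) (e j)) = - hess GB fc (snd \<kappa>B b) (eB i) (eB i) / f b"
      if i: "i < ?m1" for i
    proof -
      let ?t = "(1 / f b) *\<^sub>R eF (j - ?m1)"
      have ee: "e i = (eB i, 0)" "e j = (0, ?t)" using i j by (simp_all add: e_def)
      have tt: "gF \<kappa>F x ?t ?t = 1 / (f b)\<^sup>2"
        using eF j by (simp add: MF.form_simps orthonormal_basis_def power2_eq_square)
      \<comment> \<open>With gF(t,t) = 1/f^2, the coefficient -f of the Hessian in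
        \<open>warped_gauss\<close> becomes -1/f.\<close>
      have "- f b * (1 / (f b)\<^sup>2) * r = - r / f b" for r
        using fb by (simp add: power2_eq_square)
      then show ?thesis
        using warped_gauss[OF y(1), of "eB i" ?t]
        unfolding W_def[symmetric] Gy GFy fy tt unfolding y(3) K_def X_def h Gy ee by simp
    qed
    then show ?thesis unfolding lap by (simp add: sum_negf sum_divide_distrib)
  qed
  have H2: "mean_curvature_norm2 \<kappa> g \<kappa>N gN \<psi> p = gN \<kappa>N (\<psi> p)
      ((1 / (real ?m1 + real ?m2)) *\<^sub>R (\<Sum>i<?m1 + ?m2. ?h (e i) (e i)))
      ((1 / (real ?m1 + real ?m2)) *\<^sub>R (\<Sum>i<?m1 + ?m2. ?h (e i) (e i)))"
    using mean_curvature_vector_eq[of g \<kappa> p e \<kappa>N gN \<psi>, OF M.inner_form_axioms e hbil]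
    by (simp add: mean_curvature_norm2_def)
  have h2: "second_fundamental_form_norm2 \<kappa> g \<kappa>N gN \<psi> p = (\<Sum>i<?m1 + ?m2. \<Sum>j<?m1 + ?m2.
      gN \<kappa>N (\<psi> p) (?h (e i) (e j)) (?h (e i) (e j)))"
    using second_fundamental_form_norm2_eq[of g \<kappa> p gN \<kappa>N \<psi> e, OF M.inner_form_axioms Q.inner_form_axioms e hbil]
    by simp
  have bounds: "real ?m1 * (real ?m1 + real ?m2)\<^sup>2 / (2 * (real ?m1 + real ?m2 - 1)) *
        mean_curvature_norm2 \<kappa> g \<kappa>N gN \<psi> p -
      real ?m1 / 2 * second_fundamental_form_norm2 \<kappa> g \<kappa>N gN \<psi> p + real ?m1 * lo \<le> laplacian \<kappa>B gB f b / f b"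
    "laplacian \<kappa>B gB f b / f b \<le> (real ?m1 + real ?m2)\<^sup>2 / (4 * real ?m2) *
        mean_curvature_norm2 \<kappa> g \<kappa>N gN \<psi> p + real ?m1 * hi"
    if "\<And>i j. i < ?m1 \<Longrightarrow> ?m1 \<le> j \<Longrightarrow> j < ?m1 + ?m2 \<Longrightarrow> lo \<le> K i j"
      "\<And>i j. i < ?m1 \<Longrightarrow> ?m1 \<le> j \<Longrightarrow> j < ?m1 + ?m2 \<Longrightarrow> K i j \<le> hi" for lo hi
    unfolding H2 h2
    using Q.warped_bounds[OF DIM_positive DIM_positive, of "\<lambda>i j. ?h (e i) (e j)", OF hsym L that] by simp_all
  \<comment> \<open>K is c/4 times a factor between 1 and 4, so the sign of c decides which end
    gives the minimum.\<close>
  have K_nonneg: "c / 4 \<le> K i j" "K i j \<le> c"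
    if "c \<ge> 0" "i < ?m1" "?m1 \<le> j" "j < ?m1 + ?m2" for i j
  proof -
    let ?s = "(gN \<kappa>N (\<psi> p) (X i) (J \<kappa>N (\<psi> p) (X j)))\<^sup>2"
    have "c / 4 * 1 \<le> c / 4 * (1 + 3 * ?s)" "c / 4 * (1 + 3 * ?s) \<le> c / 4 * 4"
      using that(1) K(2)[OF that(2-4)] by (intro mult_left_mono; simp)+
    then show "c / 4 \<le> K i j" "K i j \<le> c" unfolding K(1)[OF that(2-4)] by linarith+
  qed
  have K_neg: "c \<le> K i j" "K i j \<le> c / 4"
    if "c < 0" "i < ?m1" "?m1 \<le> j" "j < ?m1 + ?m2" for i j
  proof -
    let ?s = "(gN \<kappa>N (\<psi> p) (X i) (J \<kappa>N (\<psi> p) (X j)))\<^sup>2"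
    have "c / 4 * 4 \<le> c / 4 * (1 + 3 * ?s)" "c / 4 * (1 + 3 * ?s) \<le> c / 4 * 1"
      using that(1) K(2)[OF that(2-4)] by (intro mult_left_mono_neg; simp)+
    then show "c \<le> K i j" "K i j \<le> c / 4" unfolding K(1)[OF that(2-4)] by linarith+
  qed
  show "let m1 = real DIM('e); m2 = real DIM('f); m = m1 + m2;
         \<Delta>f = laplacian \<kappa>B gB f b;
         H2 = mean_curvature_norm2 (prod_chart \<kappa>B \<kappa>F) g \<kappa>N gN \<psi> (b, x);
         h2 = second_fundamental_form_norm2 (prod_chart \<kappa>B \<kappa>F) g \<kappa>N gN \<psi> (b, x)
     in (c \<ge> 0 \<longrightarrow>
           m1 * m\<^sup>2 / (2 * (m - 1)) * H2 - m1 / 2 * h2 + m1 * (c / 4) \<le> \<Delta>f / f b \<and>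
           \<Delta>f / f b \<le> m\<^sup>2 / (4 * m2) * H2 + m1 * c) \<and>
        (c < 0 \<longrightarrow>
           m1 * m\<^sup>2 / (2 * (m - 1)) * H2 - m1 / 2 * h2 + m1 * c \<le> \<Delta>f / f b \<and>
           \<Delta>f / f b \<le> m\<^sup>2 / (4 * m2) * H2 + m1 * (c / 4))"
  proof (cases "c \<ge> 0")
    case True
    then show ?thesis
      using bounds[OF K_nonneg[OF True]] unfolding Let_def \<kappa>_def p_def by simp
  next
    case False
    then have "c < 0" by simp
    with False show ?thesis
      using bounds[OF K_neg[OF \<open>c < 0\<close>]] unfolding Let_def \<kappa>_def p_def by simp
  qed
qed

end
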